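(* Let $I=\{I_1,\dots,I_k\}$ be a $k$-cover of $[n]$ satisfying the running intersection property (RIP). Let $R=(R_1,\dots,R_k)\in\mathbb{R}^k_{++}$. For $j=1,\dots,m$, let $l_j\in[k]$, $g_j\in\mathbb{R}[x_{I_{l_j}}]$, and $U_j>0$ such that $U_j\ge\max\{g_j(x_{I_{l_j}}):\|x_{I_{l_j}}\|\le R_{l_j}\}$, be given. Let $p\in\mathbb{R}[x]=\mathbb{R}[x_1,\dots,x_n]$ be $I$-sparse and positive on $\{x\in\mathcal{B}^I_R: g_j(x_{I_{l_j}})\ge 0,\ j=1,\dots,m\}$. Then: (i) For each choice $\mathcal{K}=\mathcal{K}_{\mathrm{SONC}}$, $\mathcal{K}=\mathcal{K}_{\mathrm{SDSOS}}$, $\mathcal{K}=\mathcal{K}_{\mathrm{DSOS}}$, or $\mathcal{K}=\mathcal{K}_{\mathrm{SAG}}$, there exist $(2|I_l|+1)$-variate polynomials $\alpha_{j,l}(y_{I_l},z_{I_l},u)\in\mathcal{K}$ for $l=1,\dots,k$ and $j=0,1$, and univariate polynomials $\rho_j(u)\in\mathcal{K}$ for $j=1,\dots,m$, such that $$p(x)=\sum_{l=1}^k\Big[\alpha_{0,l}(x_{I_l}+R_le,\,R_le-x_{I_l},\,R_l^2-\|x_{I_l}\|^2)+\alpha_{1,l}(x_{I_l}+R_le,\,R_le-x_{I_l},\,R_l^2-\|x_{I_l}\|^2)\,(R_l^2-\|x_{I_l}\|^2)\Big]+\sum_{j=1}^m\rho_j(U_j-g_j(x_{I_{l_j}}))\,g_j(x_{I_{l_j}}).$$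 (ii) There exist SAG polynomials $\alpha_l(y_{I_l},z_{I_l},u)\in\mathcal{K}_{\mathrm{SAG}}$ in $2|I_l|+1$ variables for $l=1,\dots,k$, and univariate SAG polynomials $\rho_j$ for $j=1,\dots,m$, such that $$p(x)=\sum_{l=1}^k\alpha_l(x_{I_l}+R_le,\,R_le-x_{I_l},\,R_l^2-\|x_{I_l}\|^2)+\sum_{j=1}^m\rho_j(U_j-g_j(x_{I_{l_j}}))\,g_j(x_{I_{l_j}}).$$
   Context: $[n]=\{1,\dots,n\}$; $\|\cdot\|$ is the Euclidean norm; $e$ is the all-ones vector of appropriate dimension; $\mathbb{R}^k_{++}$ is the set of vectors with strictly positive entries. For $x\in\mathbb{R}^n$ and $J\subseteq[n]$, $x_J\in\mathbb{R}^J$ is the subvector of $x$ with entries $x_i$, $i\in J$, and $\mathbb{R}[x_J]$ is the ring of real polynomials in these variables. A family $I=\{I_1,\dots,I_k\}$ of subsets of $[n]$ is a $k$-cover of $[n]$ if $\bigcup_{l=1}^kI_l=[n]$. It satisfies the running intersection property (RIP) if for all $1\le l\le k-1$ one has $\big(\bigcup_{\ell=1}^{l}I_\ell\big)\cap I_{l+1}\subseteq I_j$ for some $j\le l$. A polynomial $p\in\mathbb{R}[x]$ is $I$-sparse if $p(x)=\sum_{l=1}^kp_l(x_{I_l})$ for some polynomials $p_l\in\mathbb{R}[x_{I_l}]$. The $I$-sparse ball of radius $R$ is $\mathcal{B}^I_R=\{x\in\mathbb{R}^n:\|x_{I_l}\|\le R_l,\ l=1,\dots,k\}$. The following classes of real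 polynomials are defined for any finite number $s$ of variables $w=(w_1,\dots,w_s)$. SDSOS: $q\in\mathcal{K}_{\mathrm{SDSOS}}$ if $q(w)=\sum_{l=1}^t (a_l w^{\alpha_l}+b_l w^{\beta_l})^2$ for some $t\in\mathbb{N}$, $a_l,b_l\in\mathbb{R}$ and $\alpha_l,\beta_l\in\mathbb{N}^s$. DSOS: $q\in\mathcal{K}_{\mathrm{DSOS}}$ if it has such a representation in which moreover, for each $l$, $a_l=b_l$ or $a_l=-b_l$. SONC: a circuit polynomial is a polynomial of the form $q(w)=\sum_{\alpha\in A}c_\alpha w^\alpha-d\,w^\beta$ where $d\in\mathbb{R}$, $c_\alpha>0$ for all $\alpha\in A$, $A\subseteq(2\mathbb{N})^s$ is the vertex set of a simplex (i.e. a finite nonempty affinely independent set), and $\beta\in\mathbb{N}^s$ lies in the (relative) interior of this simplex. $q\in\mathcal{K}_{\mathrm{SONC}}$ if $q$ is a finite sum of circuit polynomials each of which is non-negative on $\mathbb{R}^s$. SAG: an AM/GM polynomial is a polynomial that is non-negative on the non-negative orthant $\mathbb{R}^s_+$ and has at most one negative coefficient. $q\in\mathcal{K}_{\mathrm{SAG}}$ (a SAG polynomial) if $q$ is a finite sum of AM/GM polynomials. *)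

theory Defs
  imports "HOL-Analysis.Analysis" "HOL-Library.Poly_Mapping"
begin

text \<open>
  Real polynomials with variables indexed by a type: finitely supported maps from exponent vectors
  to coefficients. The space \<open>\<real>\<^sup>n\<close> is \<^typ>\<open>real ^ 'n\<close>, so the index set \<open>[n]\<close> is
  \<^term>\<open>UNIV :: 'n set\<close>. A polynomial ring in fewer variables is the subset \<open>polys_in J\<close>, and the
  Euclidean norm of the subvector \<open>x\<^sub>J\<close> is \<open>L2_set (($) x) J\<close>.
\<close>

type_synonym 'v mpoly = "('v \<Rightarrow>\<^sub>0 nat) \<Rightarrow>\<^sub>0 real"

definition Const :: "real \<Rightarrow> 'v mpoly" where
  "Const c = Poly_Mapping.single 0 c"

definition Var :: "'v \<Rightarrow> 'v mpoly" where
  "Var i = Poly_Mapping.single (Poly_Mapping.single i 1) 1"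

definition polys_in :: "'v set \<Rightarrow> 'v mpoly set" where
  "polys_in J = {p. \<forall>a\<in>Poly_Mapping.keys p. Poly_Mapping.keys a \<subseteq> J}"

definition mpoly_hom :: "(real \<Rightarrow> 'b) \<Rightarrow> ('v \<Rightarrow> 'b) \<Rightarrow> 'v mpoly \<Rightarrow> 'b::comm_semiring_1" where
  "mpoly_hom h f p = (\<Sum>a\<in>Poly_Mapping.keys p. h (Poly_Mapping.lookup p a) *
     (\<Prod>i\<in>Poly_Mapping.keys a. f i ^ Poly_Mapping.lookup a i))"

definition meval :: "'v mpoly \<Rightarrow> real ^ 'v::finite \<Rightarrow> real" where
  "meval p x = mpoly_hom (\<lambda>c. c) (($) x) p"

definition msubst :: "('v \<Rightarrow> 'w mpoly) \<Rightarrow> 'v mpoly \<Rightarrow> 'w mpoly" where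
  "msubst f p = mpoly_hom Const f p"


definition k_cover :: "nat \<Rightarrow> (nat \<Rightarrow> 'n set) \<Rightarrow> bool" where
  "k_cover k I \<longleftrightarrow> (\<Union>l\<in>{1..k}. I l) = UNIV"

definition RIP :: "nat \<Rightarrow> (nat \<Rightarrow> 'n set) \<Rightarrow> bool" where
  "RIP k I \<longleftrightarrow> (\<forall>l. 1 \<le> l \<and> l \<le> k - 1 \<longrightarrow>
     (\<exists>j. 1 \<le> j \<and> j \<le> l \<and> (\<Union>i\<in>{1..l}. I i) \<inter> I (l + 1) \<subseteq> I j))"

definition sparse_poly :: "nat \<Rightarrow> (nat \<Rightarrow> 'n set) \<Rightarrow> 'n mpoly \<Rightarrow> bool" where
  "sparse_poly k I p \<longleftrightarrow> (\<exists>q. (\<forall>l\<in>{1..k}. q l \<in> polys_in (I l)) \<and> p = (\<Sum>l=1..k. q l))"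

definition sparse_ball :: "nat \<Rightarrow> (nat \<Rightarrow> 'n set) \<Rightarrow> (nat \<Rightarrow> real) \<Rightarrow> (real ^ 'n::finite) set" where
  "sparse_ball k I R = {x. \<forall>l\<in>{1..k}. L2_set (($) x) (I l) \<le> R l}"


text \<open>
  The classes below consist of polynomials in the variables indexed by \<open>W\<close>; every summand has to
  be a polynomial in these variables as well.
\<close>

definition sdsos :: "'v set \<Rightarrow> 'v mpoly set" where
  "sdsos W = {q. \<exists>(t::nat) a b \<alpha> \<beta>.
     (\<forall>l\<in>{1..t}. Poly_Mapping.keys (\<alpha> l) \<subseteq> W \<and> Poly_Mapping.keys (\<beta> l) \<subseteq> W) \<and>
     q = (\<Sum>l=1..t. (Poly_Mapping.single (\<alpha> l) (a l) + Poly_Mapping.single (\<beta> l) (b l))\<^sup>2)}"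

definition dsos :: "'v set \<Rightarrow> 'v mpoly set" where
  "dsos W = {q. \<exists>(t::nat) a b \<alpha> \<beta>.
     (\<forall>l\<in>{1..t}. Poly_Mapping.keys (\<alpha> l) \<subseteq> W \<and> Poly_Mapping.keys (\<beta> l) \<subseteq> W) \<and>
     (\<forall>l\<in>{1..t}. a l = b l \<or> a l = - b l) \<and>
     q = (\<Sum>l=1..t. (Poly_Mapping.single (\<alpha> l) (a l) + Poly_Mapping.single (\<beta> l) (b l))\<^sup>2)}"

definition exponent_vec :: "('v \<Rightarrow>\<^sub>0 nat) \<Rightarrow> real ^ 'v::finite" where
  "exponent_vec a = (\<chi> i. real (Poly_Mapping.lookup a i))"

text \<open>
  The exponents live in the coordinate subspace \<open>\<real>\<^sup>W\<close> of \<^typ>\<open>real ^ 'v\<close>; affine independence and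
  relative interiors do not depend on which of the two is taken as the ambient space.
\<close>

definition circuit_poly :: "'v::finite set \<Rightarrow> 'v mpoly \<Rightarrow> bool" where
  "circuit_poly W q \<longleftrightarrow> (\<exists>A c d \<beta>.
     finite A \<and> A \<noteq> {} \<and>
     (\<forall>\<alpha>\<in>A. Poly_Mapping.keys \<alpha> \<subseteq> W \<and> (\<forall>i. even (Poly_Mapping.lookup \<alpha> i))) \<and>
     \<not> affine_dependent (exponent_vec ` A) \<and>
     Poly_Mapping.keys \<beta> \<subseteq> W \<and>
     exponent_vec \<beta> \<in> rel_interior (convex hull (exponent_vec ` A)) \<and>
     (\<forall>\<alpha>\<in>A. c \<alpha> > 0) \<and>
     q = (\<Sum>\<alpha>\<in>A. Poly_Mapping.single \<alpha> (c \<alpha>)) - Poly_Mapping.single \<beta> d)"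

definition finite_sums :: "'a::comm_monoid_add set \<Rightarrow> 'a set" where
  "finite_sums S = {sum_list qs | qs. set qs \<subseteq> S}"

definition sonc :: "'v::finite set \<Rightarrow> 'v mpoly set" where
  "sonc W = finite_sums {q. circuit_poly W q \<and> (\<forall>x. 0 \<le> meval q x)}"

definition amgm_poly :: "'v::finite set \<Rightarrow> 'v mpoly \<Rightarrow> bool" where
  "amgm_poly W q \<longleftrightarrow> q \<in> polys_in W \<and>
     (\<forall>x. (\<forall>i\<in>W. 0 \<le> x $ i) \<longrightarrow> 0 \<le> meval q x) \<and>
     card {a \<in> Poly_Mapping.keys q. Poly_Mapping.lookup q a < 0} \<le> 1"

definition sag :: "'v::finite set \<Rightarrow> 'v mpoly set" where
  "sag W = finite_sums {q. amgm_poly W q}"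

text \<open>
  The classes are used at two different variable types, so a choice of class is
  a value of the following type rather than a set of polynomials.
\<close>

datatype poly_class = SONC | SDSOS | DSOS | SAG

fun class_polys :: "poly_class \<Rightarrow> 'v::finite set \<Rightarrow> 'v mpoly set" where
  "class_polys SONC = sonc"
| "class_polys SDSOS = sdsos"
| "class_polys DSOS = dsos"
| "class_polys SAG = sag"


datatype 'n yzu = YVar 'n | ZVar 'n | UVar

instance yzu :: (finite) finite
proof
  have "(UNIV :: 'a yzu set) = range YVar \<union> range ZVar \<union> {UVar}"
  proof (intro set_eqI iffI UNIV_I)
    fix v :: "'a yzu"
    show "v \<in> range YVar \<union> range ZVar \<union> {UVar}"
      by (cases v) auto
  qed
  then show "finite (UNIV :: 'a yzu set)"
    by (metis finite finite_Un finite_imageI finite.emptyI finite_insert)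
qed

definition yzu_vars :: "'n set \<Rightarrow> 'n yzu set" where
  "yzu_vars J = YVar ` J \<union> ZVar ` J \<union> {UVar}"

definition ball_poly :: "'n set \<Rightarrow> real \<Rightarrow> 'n mpoly" where
  "ball_poly J r = Const (r\<^sup>2) - (\<Sum>i\<in>J. (Var i)\<^sup>2)"

text \<open>The substitution \<open>(y\<^sub>J, z\<^sub>J, u) = (x\<^sub>J + r e, r e - x\<^sub>J, r\<^sup>2 - \<parallel>x\<^sub>J\<parallel>\<^sup>2)\<close>.\<close>

fun yzu_map :: "'n set \<Rightarrow> real \<Rightarrow> 'n yzu \<Rightarrow> 'n mpoly" where
  "yzu_map J r (YVar i) = Var i + Const r"
| "yzu_map J r (ZVar i) = Const r - Var i"
| "yzu_map J r UVar = ball_poly J r"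

definition yzu_subst :: "'n set \<Rightarrow> real \<Rightarrow> 'n yzu mpoly \<Rightarrow> 'n mpoly" where
  "yzu_subst J r = msubst (yzu_map J r)"

text \<open>Univariate polynomials are polynomials with the single variable \<^term>\<open>()\<close>.\<close>

definition usubst :: "'n mpoly \<Rightarrow> unit mpoly \<Rightarrow> 'n mpoly" where
  "usubst h = msubst (\<lambda>_. h)"

end

theory Submission
  imports Defs
begin

text \<open>
  A single representation serves all four classes and both parts of the theorem, because every
  polynomial with non-negative coefficients and even exponents belongs to SONC, SDSOS, DSOS and SAG
  alike: a monomial \<open>c w\<^bsup>2\<beta>\<^esup>\<close> with \<open>c > 0\<close> is a degenerate circuit polynomial, the square of
  \<open>\<surd>c/2 w\<^sup>\<beta> + \<surd>c/2 w\<^sup>\<beta>\<close>, and an AM/GM polynomial without negative coefficients. So it is enough to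
  find certificates with such polynomials. In part (ii) one SAG polynomial absorbs both \<open>\<alpha>\<^sub>0\<close> and
  \<open>\<alpha>\<^sub>1\<close>, since \<open>\<alpha>\<^sub>0 + \<alpha>\<^sub>1 u\<close> still has non-negative coefficients.

  The constraints \<open>g\<^sub>j\<close> are removed first. On the sparse ball \<open>g\<^sub>j \<le> U\<^sub>j\<close>, so the multiplier
  \<open>(1 - g\<^sub>j/U\<^sub>j)\<^bsup>2N\<^esup>\<close> lies in \<open>[0,1]\<close> where \<open>g\<^sub>j \<ge> 0\<close>, and its product with \<open>g\<^sub>j\<close> is then at most
  \<open>U\<^sub>j/(2N)\<close>; where \<open>g\<^sub>j < 0\<close> the multiplier exceeds \<open>1\<close> and grows with \<open>N\<close>. Hence subtracting
  \<open>\<Sum>\<^sub>j (1 - g\<^sub>j/U\<^sub>j)\<^bsup>2N\<^esup> g\<^sub>j\<close> from \<open>p\<close> gives, for large \<open>N\<close>, a polynomial that is positive on the whole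
  sparse ball (lemma \<open>eliminate_constraints\<close>). It is still sparse, and the multipliers are even
  monomials in \<open>U\<^sub>j - g\<^sub>j\<close>.

  The running intersection property then lets the last clique be split off from the others: the two
  parts share only variables that belong to one earlier clique, so a polynomial in the shared
  variables can be moved from one part to the other without destroying sparsity, and a
  suitable choice makes both parts positive on their own domains (lemma \<open>separating_polynomial\<close>).
  By induction every summand becomes positive on its own ball (lemma
  \<open>positive_summands_on_sparse_ball\<close>).

  It remains to treat one polynomial \<open>q\<close> that is positive on one ball
  (lemma \<open>positive_on_ball_in_ball_semiring\<close>). Substituting into the admissible polynomials gives a
  semiring \<open>T\<close> that contains the non-negative constants, the squares \<open>(r \<plusminus> x\<^sub>i)\<^sup>2\<close> and
  \<open>u = r\<^sup>2 - \<parallel>x\<parallel>\<^sup>2\<close>. With \<open>n\<close> the number of variables, non-negative combinations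
  of these include \<open>U - u\<close> for \<open>U = (n + 1) r\<^sup>2\<close> and \<open>N \<plusminus> x\<^sub>i\<close> for \<open>N = (n + 1) r / 2\<close>. Eliminating the
  constraint \<open>u \<ge> 0\<close> on the box \<open>[-N, N]\<^sup>n\<close> as before changes \<open>q\<close> by an element of \<open>T\<close> and leaves a
  polynomial that is positive on the box. Its Bernstein coefficients of high degree are
  non-negative, as they approximate its values, and the Bernstein basis consists of multiples of
  products of the \<open>N \<plusminus> x\<^sub>i\<close>; so it lies in \<open>T\<close>.
\<close>

section \<open>Evaluation and substitution of polynomials\<close>

lemma poly_mapping_sum_singles:
  "p = (\<Sum>a\<in>Poly_Mapping.keys p. Poly_Mapping.single a (Poly_Mapping.lookup p a))"
  by (rule poly_mapping_eqI)
     (auto simp: lookup_sum lookup_single when_def sum.delta' in_keys_iff)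

definition monomial_value :: "('v \<Rightarrow> 'b::comm_semiring_1) \<Rightarrow> ('v \<Rightarrow>\<^sub>0 nat) \<Rightarrow> 'b" where
  "monomial_value f a = (\<Prod>i\<in>Poly_Mapping.keys a. f i ^ Poly_Mapping.lookup a i)"

lemma monomial_value_superset:
  assumes "finite A" "Poly_Mapping.keys a \<subseteq> A"
  shows "monomial_value f a = (\<Prod>i\<in>A. f i ^ Poly_Mapping.lookup a i)"
  unfolding monomial_value_def using assms
  by (intro prod.mono_neutral_left) (auto simp: in_keys_iff)

lemma monomial_value_zero [simp]: "monomial_value f 0 = 1"
  by (simp add: monomial_value_def)

lemma monomial_value_single [simp]: "monomial_value f (Poly_Mapping.single i n) = f i ^ n"
  by (cases "n = 0") (auto simp: monomial_value_def)

lemma monomial_value_add: "monomial_value f (a + b) = monomial_value f a * monomial_value f b"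
proof -
  let ?A = "Poly_Mapping.keys a \<union> Poly_Mapping.keys b"
  have "monomial_value f (a + b) = (\<Prod>i\<in>?A. f i ^ Poly_Mapping.lookup (a + b) i)"
    by (intro monomial_value_superset keys_add) auto
  then show ?thesis
    using monomial_value_superset[of ?A a f] monomial_value_superset[of ?A b f]
    by (simp add: lookup_add power_add prod.distrib)
qed

text \<open>
  Evaluation and substitution are both \<open>mpoly_hom\<close> for a homomorphism on coefficients, the identity
  and \<open>Const\<close>; their ring homomorphism laws are proved once, here.
\<close>
locale coefficient_hom =
  fixes h :: "real \<Rightarrow> 'b::comm_semiring_1"
  assumes hom_zero: "h 0 = 0" and hom_one: "h 1 = 1"
    and hom_add: "h (c + d) = h c + h d" and hom_mult: "h (c * d) = h c * h d"
begin

lemma mpoly_hom_superset: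
  assumes "finite A" "Poly_Mapping.keys p \<subseteq> A"
  shows "mpoly_hom h f p = (\<Sum>a\<in>A. h (Poly_Mapping.lookup p a) * monomial_value f a)"
  unfolding mpoly_hom_def monomial_value_def[symmetric] using assms
  by (intro sum.mono_neutral_left) (auto simp: in_keys_iff hom_zero)

lemma mpoly_hom_single [simp]:
  "mpoly_hom h f (Poly_Mapping.single a c) = h c * monomial_value f a"
  by (subst mpoly_hom_superset[of "{a}"]) (auto simp: hom_zero)

lemma mpoly_hom_add: "mpoly_hom h f (p + q) = mpoly_hom h f p + mpoly_hom h f q"
proof -
  let ?A = "Poly_Mapping.keys p \<union> Poly_Mapping.keys q"
  have "mpoly_hom h f (p + q) = (\<Sum>a\<in>?A. h (Poly_Mapping.lookup (p + q) a) * monomial_value f a)"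
    by (intro mpoly_hom_superset keys_add) auto
  then show ?thesis
    using mpoly_hom_superset[of ?A p f] mpoly_hom_superset[of ?A q f]
    by (simp add: lookup_add hom_add distrib_right sum.distrib)
qed

lemma mpoly_hom_zero [simp]: "mpoly_hom h f 0 = 0"
  by (simp add: mpoly_hom_def)

lemma mpoly_hom_sum: "mpoly_hom h f (sum q A) = (\<Sum>x\<in>A. mpoly_hom h f (q x))"
  by (induction A rule: infinite_finite_induct) (auto simp: mpoly_hom_add)

lemma mpoly_hom_mult: "mpoly_hom h f (p * q) = mpoly_hom h f p * mpoly_hom h f q"
proof -
  have "mpoly_hom h f (p * q) = mpoly_hom h f
     ((\<Sum>a\<in>Poly_Mapping.keys p. Poly_Mapping.single a (Poly_Mapping.lookup p a)) *
      (\<Sum>a\<in>Poly_Mapping.keys q. Poly_Mapping.single a (Poly_Mapping.lookup q a)))"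
    by (simp flip: poly_mapping_sum_singles)
  also have "\<dots> = mpoly_hom h f p * mpoly_hom h f q"
    unfolding sum_product mpoly_hom_sum mult_single mpoly_hom_single
    by (simp add: hom_mult monomial_value_add mpoly_hom_def flip: monomial_value_def)
       (simp add: sum_product mult_ac)
  finally show ?thesis .
qed

lemma mpoly_hom_Const [simp]: "mpoly_hom h f (Const c) = h c"
  by (simp add: Const_def)

lemma mpoly_hom_Var [simp]: "mpoly_hom h f (Var i) = f i"
  by (simp add: Var_def hom_one)

end

lemma Const_zero [simp]: "Const 0 = 0"
  and Const_one [simp]: "Const 1 = 1"
  and Const_add: "Const (c + d) = Const c + Const d"
  and Const_mult: "Const (c * d) = Const c * Const d"
  and Const_diff: "Const (c - d) = Const c - Const d"
  and Const_minus: "Const (- c) = - Const c"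
  by (simp_all add: Const_def single_add mult_single single_diff single_uminus)

lemma Const_sum: "Const (sum c A) = (\<Sum>x\<in>A. Const (c x))"
  by (induction A rule: infinite_finite_induct) (auto simp: Const_add)

lemma Const_prod: "Const (prod c A) = (\<Prod>x\<in>A. Const (c x))"
  by (induction A rule: infinite_finite_induct) (auto simp: Const_mult)

lemma of_nat_eq_Const: "of_nat n = Const (real n)"
  by (simp add: Const_def)

lemma Const_power: "Const (c ^ n) = Const c ^ n"
  by (induction n) (auto simp: Const_mult)

interpretation meval: coefficient_hom "\<lambda>c. c :: real"
  by unfold_locales auto

interpretation msubst: coefficient_hom "Const :: real \<Rightarrow> 'w mpoly"
  by unfold_locales (auto simp: Const_add Const_mult)

lemma meval_simps [simp]:
  "meval 0 x = 0"
  "meval (p + q) x = meval p x + meval q x"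
  "meval (p * q) x = meval p x * meval q x"
  "meval (Const c) x = c"
  "meval (Var i) x = x $ i"
  "meval (sum P A) x = (\<Sum>a\<in>A. meval (P a) x)"
  "meval (Poly_Mapping.single a c) x = c * monomial_value (($) x) a"
  by (simp_all add: meval_def meval.mpoly_hom_add meval.mpoly_hom_mult meval.mpoly_hom_sum)

lemma meval_one [simp]: "meval 1 x = 1"
  using meval_simps(4)[of 1] by simp

lemma meval_diff [simp]: "meval (p - q) x = meval p x - meval q x"
  using meval_simps(2)[of "p - q" q] by simp

lemma meval_power [simp]: "meval (p ^ n) x = meval p x ^ n"
  by (induction n) auto

lemma meval_prod [simp]: "meval (prod P A) x = (\<Prod>a\<in>A. meval (P a) x)"
  by (induction A rule: infinite_finite_induct) auto

lemma msubst_simps [simp]: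
  "msubst f 0 = 0"
  "msubst f (p + q) = msubst f p + msubst f q"
  "msubst f (p * q) = msubst f p * msubst f q"
  "msubst f (Const c) = Const c"
  "msubst f (Var i) = f i"
  "msubst f (sum P A) = (\<Sum>a\<in>A. msubst f (P a))"
  "msubst f (Poly_Mapping.single a c) = Const c * monomial_value f a"
  by (simp_all add: msubst_def msubst.mpoly_hom_add msubst.mpoly_hom_mult msubst.mpoly_hom_sum)

lemma msubst_diff [simp]: "msubst f (p - q) = msubst f p - msubst f q"
  using msubst_simps(2)[of f "p - q" q] by simp

lemma msubst_one [simp]: "msubst f 1 = 1"
  using msubst_simps(4)[of f 1] by simp

lemma msubst_power [simp]: "msubst f (p ^ n) = msubst f p ^ n"
  by (induction n) auto

lemma meval_monomial_expansion:
  "meval p x = (\<Sum>a\<in>Poly_Mapping.keys p. Poly_Mapping.lookup p a * monomial_value (($) x) a)"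
  by (simp add: meval_def mpoly_hom_def monomial_value_def)

lemma msubst_monomial_expansion:
  "msubst f p = (\<Sum>a\<in>Poly_Mapping.keys p. Const (Poly_Mapping.lookup p a) * monomial_value f a)"
  by (simp add: msubst_def mpoly_hom_def monomial_value_def)

lemma meval_monomial_value: "meval (monomial_value f a) x = monomial_value (\<lambda>i. meval (f i) x) a"
  by (simp add: monomial_value_def)

lemma meval_msubst: "meval (msubst f p) x = meval p (\<chi> i. meval (f i) x)"
  by (simp add: msubst_monomial_expansion meval_monomial_expansion[of p] meval_monomial_value)
     (simp add: monomial_value_def)

lemma continuous_on_meval [continuous_intros]: "continuous_on S (meval p)"
  unfolding meval_monomial_expansion[abs_def] monomial_value_def
  by (intro continuous_intros)

lemma Const_in_polys_in [simp]: "Const c \<in> polys_in J"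
  by (auto simp: polys_in_def Const_def split: if_splits)

lemma one_in_polys_in [simp]: "1 \<in> polys_in J"
  using Const_in_polys_in[of 1] by simp

lemma zero_in_polys_in [simp]: "0 \<in> polys_in J"
  using Const_in_polys_in[of 0] by simp

lemma Var_in_polys_in: "i \<in> J \<Longrightarrow> Var i \<in> polys_in J"
  by (auto simp: polys_in_def Var_def)

lemma polys_in_add: "p \<in> polys_in J \<Longrightarrow> q \<in> polys_in J \<Longrightarrow> p + q \<in> polys_in J"
  using keys_add[of p q] by (auto simp: polys_in_def)

lemma polys_in_mult:
  assumes "p \<in> polys_in J" "q \<in> polys_in J" shows "p * q \<in> polys_in J"
proof -
  have "Poly_Mapping.keys c \<subseteq> J" if c: "c \<in> Poly_Mapping.keys (p * q)" for c
  proof -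
    obtain a b where "c = a + b" "a \<in> Poly_Mapping.keys p" "b \<in> Poly_Mapping.keys q"
      using c keys_mult[of p q] by blast
    then show ?thesis using assms keys_add[of a b] unfolding polys_in_def by blast
  qed
  then show ?thesis by (auto simp: polys_in_def)
qed

lemma polys_in_diff:
  assumes "p \<in> polys_in J" "q \<in> polys_in J" shows "p - q \<in> polys_in J"
proof -
  have "p - q = p + Const (-1) * q" by (simp add: Const_minus)
  then show ?thesis using assms by (simp only:) (intro polys_in_add polys_in_mult Const_in_polys_in)
qed

lemma polys_in_sum: "(\<And>a. a \<in> A \<Longrightarrow> P a \<in> polys_in J) \<Longrightarrow> sum P A \<in> polys_in J"
  by (induction A rule: infinite_finite_induct) (auto intro: polys_in_add)

lemma polys_in_power: "p \<in> polys_in J \<Longrightarrow> p ^ n \<in> polys_in J"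
  by (induction n) (auto intro: polys_in_mult)

lemma polys_in_mono: "J \<subseteq> J' \<Longrightarrow> p \<in> polys_in J \<Longrightarrow> p \<in> polys_in J'"
  unfolding polys_in_def by blast

lemma meval_cong:
  assumes "p \<in> polys_in J" "\<And>i. i \<in> J \<Longrightarrow> x $ i = y $ i"
  shows "meval p x = meval p y"
  unfolding meval_monomial_expansion monomial_value_def
proof (intro sum.cong refl arg_cong2[where f = "(*)"] prod.cong)
  fix a i assume "a \<in> Poly_Mapping.keys p" "i \<in> Poly_Mapping.keys a"
  then have "i \<in> J" using assms(1) unfolding polys_in_def by blast
  then show "x $ i ^ Poly_Mapping.lookup a i = y $ i ^ Poly_Mapping.lookup a i" using assms(2) by simp
qed

lemma ball_poly_in_polys_in: "ball_poly J r \<in> polys_in J"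
  unfolding ball_poly_def
  by (intro polys_in_diff polys_in_sum polys_in_power Var_in_polys_in) auto

lemma meval_ball_poly: "meval (ball_poly J r) x = r\<^sup>2 - (L2_set (($) x) J)\<^sup>2"
  by (simp add: ball_poly_def L2_set_def sum_nonneg)

lemma monomial_value_Var: "monomial_value Var a = Poly_Mapping.single a 1"
proof -
  have Var_power: "Var i ^ n = Poly_Mapping.single (Poly_Mapping.single i n) 1" for i :: 'a and n
    by (induction n) (auto simp: Var_def mult_single simp flip: single_add)
  have "(\<Prod>i\<in>A. Poly_Mapping.single (Poly_Mapping.single i (n i)) (1::real)) =
      Poly_Mapping.single (\<Sum>i\<in>A. Poly_Mapping.single i (n i)) 1" for A :: "'a set" and n :: "'a \<Rightarrow> nat"
    by (induction A rule: infinite_finite_induct) (auto simp: mult_single)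
  then show ?thesis
    by (simp add: monomial_value_def Var_power flip: poly_mapping_sum_singles)
qed

lemma msubst_Var:
  assumes "p \<in> polys_in J" "\<And>i. i \<in> J \<Longrightarrow> f i = Var i"
  shows "msubst f p = p"
proof -
  have "monomial_value f a = monomial_value Var a" if "a \<in> Poly_Mapping.keys p" for a
  proof -
    have "f i = Var i" if "i \<in> Poly_Mapping.keys a" for i
      using assms \<open>a \<in> Poly_Mapping.keys p\<close> that unfolding polys_in_def by blast
    then show ?thesis by (simp add: monomial_value_def)
  qed
  then have "msubst f p = (\<Sum>a\<in>Poly_Mapping.keys p. Const (Poly_Mapping.lookup p a) * monomial_value Var a)"
    unfolding msubst_monomial_expansion by (intro sum.cong) auto
  also have "\<dots> = (\<Sum>a\<in>Poly_Mapping.keys p. Poly_Mapping.single a (Poly_Mapping.lookup p a))"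
    by (simp add: monomial_value_Var Const_def mult_single)
  also have "\<dots> = p" by (rule poly_mapping_sum_singles[symmetric])
  finally show ?thesis .
qed

lemma msubst_msubst: "msubst f (msubst g p) = msubst (\<lambda>i. msubst f (g i)) p"
proof -
  have "msubst f (prod P A) = (\<Prod>a\<in>A. msubst f (P a))" for P and A :: "'c set"
    by (induction A rule: infinite_finite_induct) auto
  then have "msubst f (monomial_value g a) = monomial_value (\<lambda>i. msubst f (g i)) a" for a
    by (simp add: monomial_value_def)
  then show ?thesis
    by (simp add: msubst_monomial_expansion[of g p] msubst_monomial_expansion[of "\<lambda>i. msubst f (g i)" p])
qed

lemma polys_in_msubst:
  assumes "p \<in> polys_in J" "\<And>i. i \<in> J \<Longrightarrow> f i \<in> polys_in J'"
  shows "msubst f p \<in> polys_in J'"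
  unfolding msubst_monomial_expansion
proof (intro polys_in_sum polys_in_mult Const_in_polys_in)
  fix a assume "a \<in> Poly_Mapping.keys p"
  then have *: "f i \<in> polys_in J'" if "i \<in> Poly_Mapping.keys a" for i
    using assms that unfolding polys_in_def by blast
  have "(\<Prod>i\<in>A. f i ^ Poly_Mapping.lookup a i) \<in> polys_in J'" if "A \<subseteq> Poly_Mapping.keys a" for A
    using that * by (induction A rule: infinite_finite_induct) (auto intro: polys_in_mult polys_in_power)
  then show "monomial_value f a \<in> polys_in J'" by (simp add: monomial_value_def)
qed

section \<open>Eliminating inequality constraints\<close>

text \<open>
  Where \<open>F \<le> 0\<close>, the function \<open>D\<close> is bounded below by a positive constant, because this set is
  compact and \<open>D\<close> does not vanish on it. A large multiple of \<open>D\<close> therefore compensates for \<open>F\<close>.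
\<close>
lemma exact_penalty:
  fixes F D :: "'a::metric_space \<Rightarrow> real"
  assumes K: "compact K" and contF: "continuous_on K F" and contD: "continuous_on K D"
    and D_nonneg: "\<And>x. x \<in> K \<Longrightarrow> 0 \<le> D x"
    and pos: "\<And>x. x \<in> K \<Longrightarrow> D x = 0 \<Longrightarrow> 0 < F x"
  obtains M \<epsilon> where "0 \<le> M" "0 < \<epsilon>" "\<And>x. x \<in> K \<Longrightarrow> \<epsilon> \<le> F x + M * D x"
proof -
  define N where "N = {x \<in> K. F x \<le> 0}"
  have "closedin (top_of_set K) N"
    unfolding N_def using continuous_closedin_preimage[OF contF closed_atMost[of 0]]
    by (simp add: vimage_def Int_def)
  then have N: "compact N" "N \<subseteq> K"
    using K closedin_compact by (auto simp: N_def)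
  obtain M where M: "0 \<le> M" "\<And>x. x \<in> K \<Longrightarrow> 0 < F x + M * D x"
  proof (cases "N = {}")
    case True
    show ?thesis
      by (rule that[of 0]) (use True in \<open>auto simp: N_def\<close>)
  next
    case False
    obtain x0 where x0: "x0 \<in> N" "\<And>x. x \<in> N \<Longrightarrow> D x0 \<le> D x"
      using continuous_attains_inf[OF N(1) False continuous_on_subset[OF contD N(2)]] by blast
    obtain x1 where x1: "x1 \<in> N" "\<And>x. x \<in> N \<Longrightarrow> F x1 \<le> F x"
      using continuous_attains_inf[OF N(1) False continuous_on_subset[OF contF N(2)]] by blast
    have D0: "0 < D x0"
      using x0(1) D_nonneg[of x0] pos[of x0] by (force simp: N_def)
    have F1: "F x1 \<le> 0" using x1 by (simp add: N_def)
    define M where "M = (1 - F x1) / D x0"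
    have "0 < F x + M * D x" if "x \<in> K" for x
    proof (cases "x \<in> N")
      case True
      have "1 - F x1 = M * D x0" using D0 by (simp add: M_def)
      also have "\<dots> \<le> M * D x"
        using x0(2)[OF True] D0 F1 by (intro mult_left_mono) (auto simp: M_def)
      finally show ?thesis using x1(2)[OF True] by simp
    next
      case False
      then have "0 < F x" using that by (simp add: N_def)
      moreover have "0 \<le> M * D x" using D0 F1 D_nonneg[OF that] by (simp add: M_def)
      ultimately show ?thesis by simp
    qed
    then show ?thesis using that[of M] D0 F1 by (simp add: M_def)
  qed
  show ?thesis
  proof (cases "K = {}")
    case True
    show ?thesis by (rule that[of 0 1]) (use True in auto)
  next
    case False
    have "continuous_on K (\<lambda>x. F x + M * D x)"
      using contF contD by (intro continuous_intros)
    then obtain x where "x \<in> K" "\<And>y. y \<in> K \<Longrightarrow> F x + M * D x \<le> F y + M * D y"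
      using continuous_attains_inf[OF K False] by blast
    then show ?thesis using that[of M "F x + M * D x"] M by blast
  qed
qed

text \<open>
  The function \<open>t \<mapsto> -(1 - t/U)\<^bsup>2N\<^esup> t\<close> is almost as good as the penalty \<open>M max(0, -t)\<close>, with the
  advantage of being polynomial. For \<open>0 \<le> t \<le> U\<close> and \<open>v = t/U\<close> the bound comes from
  \<open>(1 - v)\<^bsup>2N\<^esup> (1 + 2N v) \<le> ((1 - v)(1 + v))\<^bsup>2N\<^esup> \<le> 1\<close>. For \<open>t = -s < 0\<close> Bernoulli's inequality gives a
  quadratic lower bound in \<open>s\<close>, which beats the linear function \<open>M s - \<eta>\<close> for large \<open>N\<close>.
\<close>
lemma power_multiplier_bound:
  fixes M \<eta> U t :: real
  assumes "0 < U" "0 < \<eta>" "t \<le> U"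
    and N: "M\<^sup>2 * U / \<eta> \<le> real N" "U / \<eta> \<le> real N"
  shows "M * max 0 (- t) - \<eta> \<le> - (((U - t) / U) ^ (2 * N) * t)"
proof (cases "0 \<le> t")
  case True
  define v where "v = t / U"
  have v: "0 \<le> v" "v \<le> 1" using assms True by (auto simp: v_def)
  have N0: "0 < real N" using N(2) assms by (smt (verit) divide_pos_pos)
  have eq: "(U - t) / U = 1 - v" using assms by (simp add: v_def field_simps)
  have "(1 - v) ^ (2 * N) * (real (2 * N) * v) \<le> (1 - v) ^ (2 * N) * (1 + v) ^ (2 * N)"
    using v Bernoulli_inequality[of v "2 * N"] by (intro mult_left_mono) auto
  also have "\<dots> = (1 - v\<^sup>2) ^ (2 * N)"
    by (simp add: power2_eq_square algebra_simps flip: power_mult_distrib)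
  also have "\<dots> \<le> 1" using v by (intro power_le_one) (auto simp: power_le_one)
  finally have "(1 - v) ^ (2 * N) * v \<le> 1 / real (2 * N)"
    using N0 by (simp add: field_simps)
  then have "(1 - v) ^ (2 * N) * v * U \<le> 1 / real (2 * N) * U"
    using assms by (intro mult_right_mono) auto
  also have "\<dots> \<le> \<eta>" using N(2) N0 assms by (simp add: field_simps)
  finally show ?thesis unfolding eq using True assms by (simp add: v_def)
next
  case False
  define s where "s = - t"
  have s: "0 < s" using False by (simp add: s_def)
  have eq: "(U - t) / U = 1 + s / U" using assms by (simp add: s_def field_simps)
  \<comment> \<open>Completing the square replaces the linear function by a quadratic one.\<close>
  have "M * s - \<eta> \<le> (M * s)\<^sup>2 / \<eta>"
  proof -
    have "0 \<le> (M * s - \<eta> / 2)\<^sup>2 + 3 / 4 * \<eta>\<^sup>2" by simp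
    also have "\<dots> = (M * s)\<^sup>2 - (M * s - \<eta>) * \<eta>"
      by (simp add: power2_eq_square algebra_simps)
    finally have "(M * s - \<eta>) * \<eta> \<le> (M * s)\<^sup>2" by simp
    then show ?thesis using assms by (simp add: field_simps)
  qed
  also have "\<dots> = (M\<^sup>2 * U / \<eta>) * (s\<^sup>2 / U)" using assms by (simp add: field_simps)
  also have "\<dots> \<le> real N * (s\<^sup>2 / U)" using assms by (intro mult_right_mono N(1)) auto
  also have "\<dots> \<le> (1 + real (2 * N) * (s / U)) * s"
    using assms s by (simp add: field_simps power2_eq_square)
  also have "\<dots> \<le> (1 + s / U) ^ (2 * N) * s"
    using assms s Bernoulli_inequality[of "s / U" "2 * N"]
    by (intro mult_right_mono) (auto simp: order.trans[of "-1" 0])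
  finally show ?thesis unfolding eq using s by (simp add: s_def)
qed

text \<open>
  The violation \<open>\<Sum>\<^sub>j max(0, -g\<^sub>j)\<close> is an exact penalty for the constraints; each of its terms is then
  replaced by a power multiplier at a cost of \<open>\<eta>\<close>, chosen so that the total cost stays below the
  margin \<open>\<epsilon>\<close>.
\<close>
lemma eliminate_constraints:
  fixes p :: "'a::metric_space \<Rightarrow> real" and g :: "'j \<Rightarrow> 'a \<Rightarrow> real"
  assumes K: "compact K" and contp: "continuous_on K p"
    and J: "finite J" and contg: "\<And>j. j \<in> J \<Longrightarrow> continuous_on K (g j)"
    and U_pos: "\<And>j. j \<in> J \<Longrightarrow> 0 < U j"
    and U: "\<And>j x. j \<in> J \<Longrightarrow> x \<in> K \<Longrightarrow> g j x \<le> U j"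
    and pos: "\<And>x. x \<in> K \<Longrightarrow> (\<And>j. j \<in> J \<Longrightarrow> 0 \<le> g j x) \<Longrightarrow> 0 < p x"
  obtains N :: nat where
    "\<And>x. x \<in> K \<Longrightarrow> 0 < p x - (\<Sum>j\<in>J. ((U j - g j x) / U j) ^ (2 * N) * g j x)"
proof -
  define D where "D x = (\<Sum>j\<in>J. max 0 (- g j x))" for x
  have "continuous_on K D"
    unfolding D_def[abs_def] using contg by (intro continuous_intros) auto
  moreover have "0 \<le> D x" for x by (simp add: D_def sum_nonneg)
  moreover have "0 < p x" if "x \<in> K" "D x = 0" for x
  proof (rule pos[OF that(1)])
    fix j assume j: "j \<in> J"
    have "max 0 (- g j x) = 0"
      using that(2) j J unfolding D_def by (subst (asm) sum_nonneg_eq_0_iff) auto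
    then show "0 \<le> g j x" by simp
  qed
  ultimately obtain M \<epsilon> where M: "0 \<le> M" "0 < \<epsilon>" "\<And>x. x \<in> K \<Longrightarrow> \<epsilon> \<le> p x + M * D x"
    using exact_penalty[OF K contp, of D] by metis
  define \<eta> where "\<eta> = \<epsilon> / (real (card J) + 1)"
  have \<eta>: "0 < \<eta>" using M by (simp add: \<eta>_def add_nonneg_pos)
  have \<eta>_sum: "real (card J) * \<eta> < \<epsilon>" using M by (simp add: \<eta>_def field_simps add_nonneg_pos)
  define N where "N = nat \<lceil>\<Sum>j\<in>J. M\<^sup>2 * U j / \<eta> + U j / \<eta>\<rceil>"
  have N: "M\<^sup>2 * U j / \<eta> \<le> real N" "U j / \<eta> \<le> real N" if "j \<in> J" for j
  proof -
    have "M\<^sup>2 * U j / \<eta> + U j / \<eta> \<le> (\<Sum>j\<in>J. M\<^sup>2 * U j / \<eta> + U j / \<eta>)"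
      using J that U_pos \<eta> by (intro member_le_sum) (auto intro!: add_nonneg_nonneg simp: less_imp_le)
    also have "\<dots> \<le> real N" unfolding N_def by linarith
    finally have *: "M\<^sup>2 * U j / \<eta> + U j / \<eta> \<le> real N" .
    have "0 \<le> M\<^sup>2 * U j / \<eta>" "0 \<le> U j / \<eta>" using U_pos[OF that] \<eta> by auto
    with * show "M\<^sup>2 * U j / \<eta> \<le> real N" "U j / \<eta> \<le> real N" by linarith+
  qed
  have "0 < p x - (\<Sum>j\<in>J. ((U j - g j x) / U j) ^ (2 * N) * g j x)" if x: "x \<in> K" for x
  proof -
    have "M * D x - real (card J) * \<eta> = (\<Sum>j\<in>J. M * max 0 (- g j x) - \<eta>)"
      by (simp add: D_def sum_subtractf sum_distrib_left)
    also have "\<dots> \<le> (\<Sum>j\<in>J. - (((U j - g j x) / U j) ^ (2 * N) * g j x))"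
      using x U U_pos \<eta> N by (intro sum_mono power_multiplier_bound) auto
    finally show ?thesis
      using M(3)[OF x] \<eta>_sum by (simp add: sum_negf)
  qed
  then show ?thesis by (rule that)
qed

section \<open>Splitting along the cliques\<close>

text \<open>
  The subvector \<open>x\<^sub>Y\<close>, padded with zeros so that it stays in the same space.
\<close>
definition coord_proj :: "'n set \<Rightarrow> real ^ 'n \<Rightarrow> real ^ 'n" where
  "coord_proj Y x = (\<chi> i. if i \<in> Y then x $ i else 0)"

lemma continuous_on_coord_proj [continuous_intros]:
  "continuous_on S (coord_proj Y :: real ^ 'n::finite \<Rightarrow> _)"
proof -
  have "continuous_on S (\<lambda>x :: real ^ 'n. if i \<in> Y then x $ i else 0)" for i
    by (cases "i \<in> Y") (auto intro!: continuous_intros)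
  then show ?thesis unfolding coord_proj_def[abs_def] by (intro continuous_on_vec_lambda)
qed

text \<open>
  Converts the analytic notion of polynomial function, for which the Stone-Weierstrass theorem is
  stated, into a polynomial in the variables \<open>Y\<close> only.
\<close>
lemma real_polynomial_function_as_mpoly:
  fixes f :: "real ^ 'n::finite \<Rightarrow> real"
  assumes "real_polynomial_function f"
  shows "\<exists>q\<in>polys_in Y. \<forall>x. meval q x = f (coord_proj Y x)"
  using assms
proof (induction rule: real_polynomial_function.induct)
  case (linear f)
  define q :: "'n mpoly" where "q = (\<Sum>i\<in>Y. Const (f (axis i 1)) * Var i)"
  have "meval q x = f (coord_proj Y x)" for x
  proof -
    interpret bounded_linear f by fact
    have "coord_proj Y x = (\<Sum>i\<in>Y. (x $ i) *\<^sub>R axis i 1)"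
      by (auto simp: vec_eq_iff coord_proj_def axis_def if_distrib[of "(*) _"] cong: if_cong)
    then show ?thesis by (simp add: q_def sum scaleR mult.commute)
  qed
  moreover have "q \<in> polys_in Y"
    unfolding q_def by (intro polys_in_sum polys_in_mult Var_in_polys_in) auto
  ultimately show ?case by blast
next
  case (const c)
  show ?case by (rule bexI[of _ "Const c"]) auto
next
  case (add f g)
  then obtain q r where "q \<in> polys_in Y" "r \<in> polys_in Y"
    "\<And>x. meval q x = f (coord_proj Y x)" "\<And>x. meval r x = g (coord_proj Y x)" by blast
  then show ?case by (intro bexI[of _ "q + r"]) (auto intro: polys_in_add)
next
  case (mult f g)
  then obtain q r where "q \<in> polys_in Y" "r \<in> polys_in Y"
    "\<And>x. meval q x = f (coord_proj Y x)" "\<And>x. meval r x = g (coord_proj Y x)" by blast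
  then show ?case by (intro bexI[of _ "q * r"]) (auto intro: polys_in_mult)
qed

text \<open>
  Fixing the shared coordinates, the minimum of \<open>f2\<close> would be a natural function to transfer, but
  it need not be continuous, and may be taken over an empty fibre. Penalising the distance between
  the shared coordinates instead of requiring them to agree leads to
  \<open>h\<^sub>0 v = inf\<^sub>y (f2 y + M \<parallel>v - y\<^sub>Y\<parallel>)\<close>, which is Lipschitz. It satisfies \<open>h\<^sub>0 y\<^sub>Y \<le> f2 y\<close>
  trivially and \<open>f1 x + h\<^sub>0 x\<^sub>Y \<ge> \<epsilon>\<close> by the exact penalty bound, so a polynomial close to
  \<open>h\<^sub>0 - \<epsilon>/2\<close> does the job.
\<close>
lemma separating_polynomial:
  fixes f1 f2 :: "real ^ 'n::finite \<Rightarrow> real"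
  assumes A1: "compact A1" and A2: "compact A2" "A2 \<noteq> {}"
    and f1: "continuous_on A1 f1" and f2: "continuous_on A2 f2"
    and pos: "\<And>x y. x \<in> A1 \<Longrightarrow> y \<in> A2 \<Longrightarrow> (\<And>i. i \<in> Y \<Longrightarrow> x $ i = y $ i) \<Longrightarrow> 0 < f1 x + f2 y"
  obtains h where "h \<in> polys_in Y" "\<And>x. x \<in> A1 \<Longrightarrow> 0 < f1 x + meval h x"
    "\<And>y. y \<in> A2 \<Longrightarrow> 0 < f2 y - meval h y"
proof -
  let ?\<pi> = "coord_proj Y :: real ^ 'n \<Rightarrow> _"
  obtain M \<epsilon> where M: "0 \<le> M" "0 < \<epsilon>"
    "\<And>z. z \<in> A1 \<times> A2 \<Longrightarrow> \<epsilon> \<le> (f1 (fst z) + f2 (snd z)) + M * dist (?\<pi> (fst z)) (?\<pi> (snd z))"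
  proof (rule exact_penalty)
    show "compact (A1 \<times> A2)" using A1 A2 by (intro compact_Times)
    show "continuous_on (A1 \<times> A2) (\<lambda>z. f1 (fst z) + f2 (snd z))"
      by (intro continuous_intros continuous_on_compose2[OF f1] continuous_on_compose2[OF f2]) auto
    show "continuous_on (A1 \<times> A2) (\<lambda>z. dist (?\<pi> (fst z)) (?\<pi> (snd z)))"
      by (intro continuous_intros continuous_on_compose2[OF continuous_on_coord_proj[of UNIV]]) auto
    show "0 < f1 (fst z) + f2 (snd z)"
      if "z \<in> A1 \<times> A2" "dist (?\<pi> (fst z)) (?\<pi> (snd z)) = 0" for z
    proof (rule pos)
      show "fst z $ i = snd z $ i" if "i \<in> Y" for i
        using \<open>dist _ _ = 0\<close> that by (auto simp: coord_proj_def vec_eq_iff split: if_splits)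
    qed (use that in auto)
  qed auto
  define h0 where "h0 v = (INF y\<in>A2. f2 y + M * dist v (?\<pi> y))" for v
  obtain y0 where y0: "y0 \<in> A2" "\<And>y. y \<in> A2 \<Longrightarrow> f2 y0 \<le> f2 y"
    using continuous_attains_inf[OF A2 f2] by blast
  have "f2 y0 \<le> f2 y + M * dist v (?\<pi> y)" if "y \<in> A2" for y v
    using y0(2)[OF that] M(1) by (simp add: add_increasing2)
  then have bdd: "bdd_below ((\<lambda>y. f2 y + M * dist v (?\<pi> y)) ` A2)" for v
    by (intro bdd_belowI2)
  have h0_le: "h0 v \<le> f2 y + M * dist v (?\<pi> y)" if "y \<in> A2" for v y
    unfolding h0_def by (rule cINF_lower[OF bdd that])
  have h0_lipschitz: "h0 v \<le> h0 w + M * dist v w" for v w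
  proof -
    have "h0 v - M * dist v w \<le> f2 y + M * dist w (?\<pi> y)" if "y \<in> A2" for y
    proof -
      have "M * dist v (?\<pi> y) \<le> M * (dist v w + dist w (?\<pi> y))"
        using M(1) by (intro mult_left_mono dist_triangle)
      then show ?thesis using h0_le[OF that, of v] by (simp add: algebra_simps)
    qed
    then have "h0 v - M * dist v w \<le> h0 w"
      unfolding h0_def[of w] using A2(2) by (intro cINF_greatest) auto
    then show ?thesis by simp
  qed
  have "M-lipschitz_on UNIV h0"
  proof (rule lipschitz_onI)
    show "dist (h0 v) (h0 w) \<le> M * dist v w" for v w
      using h0_lipschitz[of v w] h0_lipschitz[of w v]
      by (simp add: dist_real_def abs_le_iff dist_commute)
  qed (rule M(1))
  then have "continuous_on UNIV h0" by (rule lipschitz_on_continuous_on)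
  define S where "S = ?\<pi> ` A1 \<union> ?\<pi> ` A2"
  have "compact S"
    unfolding S_def using A1 A2 by (intro compact_Un compact_continuous_image continuous_intros)
  moreover have "continuous_on S (\<lambda>v. h0 v - \<epsilon> / 2)"
    using continuous_on_subset[OF \<open>continuous_on UNIV h0\<close>, of S]
    by (intro continuous_on_diff continuous_on_const) auto
  ultimately obtain G where G: "real_polynomial_function G"
    "\<And>v. v \<in> S \<Longrightarrow> \<bar>h0 v - \<epsilon> / 2 - G v\<bar> < \<epsilon> / 2"
    using Stone_Weierstrass_real_polynomial_function[of S "\<lambda>v. h0 v - \<epsilon> / 2" "\<epsilon> / 2"] half_gt_zero[OF M(2)]
    by blast
  obtain h where h: "h \<in> polys_in Y" "\<And>x. meval h x = G (?\<pi> x)"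
    using real_polynomial_function_as_mpoly[OF G(1)] by blast
  show ?thesis
  proof (rule that[OF h(1)])
    fix x assume x: "x \<in> A1"
    have "\<epsilon> - f1 x \<le> f2 y + M * dist (?\<pi> x) (?\<pi> y)" if "y \<in> A2" for y
      using M(3)[of "(x, y)"] x that by simp
    then have "\<epsilon> - f1 x \<le> h0 (?\<pi> x)"
      unfolding h0_def using A2(2) by (intro cINF_greatest) auto
    moreover have "\<bar>h0 (?\<pi> x) - \<epsilon> / 2 - G (?\<pi> x)\<bar> < \<epsilon> / 2" using x by (intro G) (auto simp: S_def)
    ultimately show "0 < f1 x + meval h x" unfolding h by linarith
  next
    fix y assume y: "y \<in> A2"
    have "h0 (?\<pi> y) \<le> f2 y" using h0_le[OF y, of "?\<pi> y"] by simp
    moreover have "\<bar>h0 (?\<pi> y) - \<epsilon> / 2 - G (?\<pi> y)\<bar> < \<epsilon> / 2" using y by (intro G) (auto simp: S_def)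
    ultimately show "0 < f2 y - meval h y" unfolding h by linarith
  qed
qed

lemma compact_coordinate_balls:
  fixes I :: "'l \<Rightarrow> 'n::finite set"
  assumes "finite L"
  shows "compact {x :: real ^ 'n. (\<forall>l\<in>L. L2_set (($) x) (I l) \<le> R l) \<and> (\<forall>i. i \<notin> (\<Union>l\<in>L. I l) \<longrightarrow> x $ i = 0)}"
    (is "compact ?S")
proof -
  have "closed {x :: real ^ 'n. L2_set (($) x) (I l) \<le> R l}" for l
    unfolding L2_set_def by (intro closed_Collect_le continuous_intros)
  moreover have "closed {x :: real ^ 'n. x $ i = 0}" for i
    by (intro closed_Collect_eq continuous_intros)
  moreover have "?S = (\<Inter>l\<in>L. {x. L2_set (($) x) (I l) \<le> R l}) \<inter> (\<Inter>i\<in>- (\<Union>l\<in>L. I l). {x. x $ i = 0})"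
    by auto
  ultimately have "closed ?S" by (simp only:) (intro closed_Int closed_INT ballI)
  moreover have "bounded ?S"
  proof (rule boundedI)
    fix x :: "real ^ 'n" assume x: "x \<in> ?S"
    have "\<bar>x $ i\<bar> \<le> (\<Sum>l\<in>L. \<bar>R l\<bar>)" for i
    proof (cases "i \<in> (\<Union>l\<in>L. I l)")
      case True
      then obtain l where l: "l \<in> L" "i \<in> I l" by blast
      have "\<bar>x $ i\<bar> \<le> L2_set (\<lambda>i. \<bar>x $ i\<bar>) (I l)" by (rule member_le_L2_set) (use l in auto)
      also have "\<dots> = L2_set (($) x) (I l)" by (simp add: L2_set_def)
      also have "\<dots> \<le> R l" using x l by blast
      also have "\<dots> \<le> \<bar>R l\<bar>" by simp
      also have "\<dots> \<le> (\<Sum>l\<in>L. \<bar>R l\<bar>)" using l assms by (intro member_le_sum) auto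
      finally show ?thesis .
    next
      case False
      then have "x $ i = 0" using x by blast
      then show ?thesis by (simp add: sum_nonneg)
    qed
    then have "(\<Sum>i\<in>UNIV. \<bar>x $ i\<bar>) \<le> (\<Sum>i\<in>(UNIV :: 'n set). \<Sum>l\<in>L. \<bar>R l\<bar>)"
      by (intro sum_mono)
    then show "norm x \<le> (\<Sum>i\<in>(UNIV :: 'n set). \<Sum>l\<in>L. \<bar>R l\<bar>)"
      using norm_le_l1_cart[of x] by linarith
  qed
  ultimately show ?thesis by (simp add: compact_eq_bounded_closed)
qed

lemma L2_set_coord_proj:
  "J \<subseteq> J' \<Longrightarrow> L2_set (($) (coord_proj J' x)) J = L2_set (($) x) J"
  by (intro L2_set_cong) (auto simp: coord_proj_def)

lemma meval_coord_proj:
  "p \<in> polys_in J \<Longrightarrow> J \<subseteq> J' \<Longrightarrow> meval p (coord_proj J' x) = meval p x"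
  by (rule meval_cong) (auto simp: coord_proj_def)

text \<open>
  The last clique meets the union \<open>J\<close> of the earlier ones inside some \<open>I j\<close>. A separating polynomial
  in the shared variables is subtracted from the last summand and added to the \<open>j\<close>-th one, and the
  induction hypothesis applies to the remaining summands. Points of the two domains that agree on
  the shared variables combine to one point of the full sparse ball, which is where positivity of
  the sum enters. Setting the irrelevant coordinates to zero makes both domains compact.
\<close>
lemma positive_summands_on_sparse_ball:
  fixes I :: "nat \<Rightarrow> 'n::finite set" and q :: "nat \<Rightarrow> 'n mpoly"
  assumes "1 \<le> k" "RIP k I" "\<forall>l\<in>{1..k}. 0 < R l" "\<forall>l\<in>{1..k}. q l \<in> polys_in (I l)"
    and "\<forall>x\<in>sparse_ball k I R. 0 < (\<Sum>l=1..k. meval (q l) x)"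
  shows "\<exists>q'. (\<forall>l\<in>{1..k}. q' l \<in> polys_in (I l)) \<and> (\<Sum>l=1..k. q' l) = (\<Sum>l=1..k. q l) \<and>
    (\<forall>l\<in>{1..k}. \<forall>x. L2_set (($) x) (I l) \<le> R l \<longrightarrow> 0 < meval (q' l) x)"
  using assms
proof (induction k arbitrary: q rule: nat_induct_at_least)
  case base
  then show ?case by (intro exI[of _ q]) (auto simp: sparse_ball_def)
next
  case (Suc k)
  define J where "J = (\<Union>i\<in>{1..k}. I i)"
  define J' where "J' = I (Suc k)"
  define Y where "Y = J \<inter> J'"
  have "1 \<le> k \<and> k \<le> Suc k - 1" using Suc.hyps by simp
  then have "\<exists>j. 1 \<le> j \<and> j \<le> k \<and> J \<inter> I (k + 1) \<subseteq> I j"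
    using Suc.prems(1) unfolding RIP_def J_def by blast
  then obtain j where j: "1 \<le> j" "j \<le> k" "Y \<subseteq> I j"
    by (auto simp: Y_def J'_def)
  have "l \<le> Suc k - 1" if "l \<le> k - 1" for l using that by simp
  then have rip: "RIP k I" using Suc.prems(1) unfolding RIP_def by blast
  have IJ: "I l \<subseteq> J" if "l \<in> {1..k}" for l using that by (auto simp: J_def)
  have q: "q l \<in> polys_in (I l)" if "l \<in> {1..k}" for l using Suc.prems(3) that by simp
  have q': "q (Suc k) \<in> polys_in J'" using Suc.prems(3) by (simp add: J'_def)
  define A1 where "A1 = {x :: real ^ 'n. (\<forall>l\<in>{1..k}. L2_set (($) x) (I l) \<le> R l) \<and> (\<forall>i. i \<notin> J \<longrightarrow> x $ i = 0)}"
  define A2 where "A2 = {x :: real ^ 'n. L2_set (($) x) J' \<le> R (Suc k) \<and> (\<forall>i. i \<notin> J' \<longrightarrow> x $ i = 0)}"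
  have A1: "compact A1"
    using compact_coordinate_balls[of "{1..k}" I R] by (simp add: A1_def J_def)
  have A2: "compact A2"
    using compact_coordinate_balls[of "{Suc k}" I R] by (simp add: A2_def J'_def)
  have "0 \<in> A2" using Suc.prems(2) by (simp add: A2_def L2_set_def less_imp_le)
  obtain h where h: "h \<in> polys_in Y"
    "\<And>x. x \<in> A1 \<Longrightarrow> 0 < (\<Sum>l=1..k. meval (q l) x) + meval h x"
    "\<And>x. x \<in> A2 \<Longrightarrow> 0 < meval (q (Suc k)) x - meval h x"
  proof (rule separating_polynomial[of A1 A2 "\<lambda>x. \<Sum>l=1..k. meval (q l) x" "meval (q (Suc k))" Y])
    fix x y :: "real ^ 'n"
    assume x: "x \<in> A1" and y: "y \<in> A2" and agree: "\<And>i. i \<in> Y \<Longrightarrow> x $ i = y $ i"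
    \<comment> \<open>The common extension of \<open>x\<close> and \<open>y\<close>.\<close>
    define z :: "real ^ 'n" where "z = (\<chi> i. if i \<in> J then x $ i else y $ i)"
    have zx: "z $ i = x $ i" if "i \<in> J" for i using that by (simp add: z_def)
    have zy: "z $ i = y $ i" if "i \<in> J'" for i using that agree by (simp add: z_def Y_def)
    have "L2_set (($) z) (I l) \<le> R l" if "l \<in> {1..k}" for l
    proof -
      have "L2_set (($) z) (I l) = L2_set (($) x) (I l)"
        using IJ[OF that] by (intro L2_set_cong zx) auto
      then show ?thesis using x that by (simp add: A1_def)
    qed
    moreover have "L2_set (($) z) J' = L2_set (($) y) J'"
      by (intro L2_set_cong zy) auto
    then have "L2_set (($) z) J' \<le> R (Suc k)" using y by (simp add: A2_def)
    ultimately have "z \<in> sparse_ball (Suc k) I R"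
      by (auto simp: sparse_ball_def J'_def le_Suc_eq)
    then have "0 < (\<Sum>l=1..Suc k. meval (q l) z)" using Suc.prems(4) by blast
    also have "\<dots> = (\<Sum>l=1..k. meval (q l) z) + meval (q (Suc k)) z" by simp
    also have "(\<Sum>l=1..k. meval (q l) z) = (\<Sum>l=1..k. meval (q l) x)"
      using IJ by (intro sum.cong refl meval_cong[OF q] zx) auto
    also have "meval (q (Suc k)) z = meval (q (Suc k)) y"
      by (rule meval_cong[OF q' zy])
    finally show "0 < (\<Sum>l=1..k. meval (q l) x) + meval (q (Suc k)) y" .
  qed (use A1 A2 \<open>0 \<in> A2\<close> in \<open>auto intro!: continuous_intros\<close>)
  define q1 where "q1 l = q l + (if l = j then h else 0)" for l
  have q1_sum: "(\<Sum>l=1..k. q1 l) = (\<Sum>l=1..k. q l) + h"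
    using j by (simp add: q1_def sum.distrib)
  have "h \<in> polys_in J" "h \<in> polys_in J'" "h \<in> polys_in (I j)"
    using h(1) j(3) polys_in_mono[of Y] by (auto simp: Y_def)
  have "\<exists>q'. (\<forall>l\<in>{1..k}. q' l \<in> polys_in (I l)) \<and> (\<Sum>l=1..k. q' l) = (\<Sum>l=1..k. q1 l) \<and>
    (\<forall>l\<in>{1..k}. \<forall>x. L2_set (($) x) (I l) \<le> R l \<longrightarrow> 0 < meval (q' l) x)"
  proof (rule Suc.IH[OF rip])
    show "\<forall>l\<in>{1..k}. 0 < R l" using Suc.prems(2) by simp
    show "\<forall>l\<in>{1..k}. q1 l \<in> polys_in (I l)"
      using q \<open>h \<in> polys_in (I j)\<close> by (auto simp: q1_def intro: polys_in_add)
    show "\<forall>x\<in>sparse_ball k I R. 0 < (\<Sum>l=1..k. meval (q1 l) x)"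
    proof
      fix x assume x: "x \<in> sparse_ball k I R"
      have "L2_set (($) (coord_proj J x)) (I l) \<le> R l" if "l \<in> {1..k}" for l
        using x that by (simp add: L2_set_coord_proj[OF IJ[OF that]] sparse_ball_def)
      then have "coord_proj J x \<in> A1" by (simp add: A1_def) (simp add: coord_proj_def)
      from h(2)[OF this]
      have "0 < (\<Sum>l=1..k. meval (q l) (coord_proj J x)) + meval h (coord_proj J x)" .
      also have "meval h (coord_proj J x) = meval h x"
        by (rule meval_coord_proj[OF \<open>h \<in> polys_in J\<close>]) simp
      also have "(\<Sum>l=1..k. meval (q l) (coord_proj J x)) = (\<Sum>l=1..k. meval (q l) x)"
        using IJ by (intro sum.cong refl meval_coord_proj[OF q])
      also have "\<dots> + meval h x = meval (\<Sum>l=1..k. q1 l) x"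
        unfolding q1_sum by simp
      finally show "0 < (\<Sum>l=1..k. meval (q1 l) x)" by simp
    qed
  qed
  then obtain q2 where q2: "\<forall>l\<in>{1..k}. q2 l \<in> polys_in (I l)" "(\<Sum>l=1..k. q2 l) = (\<Sum>l=1..k. q1 l)"
    "\<forall>l\<in>{1..k}. \<forall>x. L2_set (($) x) (I l) \<le> R l \<longrightarrow> 0 < meval (q2 l) x" by blast
  define q3 where "q3 = q2(Suc k := q (Suc k) - h)"
  have q3: "q3 l = q2 l" if "l \<in> {1..k}" for l using that by (auto simp: q3_def)
  have q3': "q3 (Suc k) = q (Suc k) - h" by (simp add: q3_def)
  have range: "{1..Suc k} = insert (Suc k) {1..k}" by auto
  have "(\<Sum>l=1..k. q3 l) = (\<Sum>l=1..k. q2 l)" by (intro sum.cong refl q3)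
  then have "(\<Sum>l=1..Suc k. q3 l) = (\<Sum>l=1..Suc k. q l)"
    using q2(2) q1_sum by (simp add: q3')
  moreover have "q (Suc k) - h \<in> polys_in (I (Suc k))"
    using q' \<open>h \<in> polys_in J'\<close> by (simp add: J'_def polys_in_diff)
  moreover have "0 < meval (q (Suc k) - h) x" if "L2_set (($) x) (I (Suc k)) \<le> R (Suc k)" for x
  proof -
    have "coord_proj J' x \<in> A2"
      using that by (simp add: A2_def L2_set_coord_proj) (simp add: coord_proj_def J'_def)
    from h(3)[OF this] show ?thesis
      using meval_coord_proj[OF q' order_refl, of x] meval_coord_proj[OF \<open>h \<in> polys_in J'\<close> order_refl, of x]
      by simp
  qed
  ultimately show ?case
    using q2 q3 q3' unfolding range by (intro exI[of _ q3]) simp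
qed

section \<open>Bernstein expansions with coefficients in a semiring\<close>

text \<open>
  A preprime of the polynomial algebra, as in the Archimedean representation theorem of
  Krivine, Kadison and Dubois.
\<close>
definition nonneg_semiring :: "'v mpoly set \<Rightarrow> bool" where
  "nonneg_semiring T \<longleftrightarrow> (\<forall>c\<ge>0. Const c \<in> T) \<and>
     (\<forall>p\<in>T. \<forall>q\<in>T. p + q \<in> T) \<and> (\<forall>p\<in>T. \<forall>q\<in>T. p * q \<in> T)"

lemma nonneg_semiringD:
  assumes "nonneg_semiring T"
  shows "0 \<le> c \<Longrightarrow> Const c \<in> T" "p \<in> T \<Longrightarrow> q \<in> T \<Longrightarrow> p + q \<in> T"
    "p \<in> T \<Longrightarrow> q \<in> T \<Longrightarrow> p * q \<in> T" "0 \<in> T" "1 \<in> T"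
  using assms Const_zero Const_one unfolding nonneg_semiring_def
  by (blast, blast, blast, metis order_refl, metis zero_le_one)

lemma nonneg_semiring_sum:
  assumes "nonneg_semiring T" "\<And>a. a \<in> A \<Longrightarrow> P a \<in> T"
  shows "sum P A \<in> T"
  using assms(2)
  by (induction A rule: infinite_finite_induct) (auto intro: nonneg_semiringD[OF assms(1)])

lemma nonneg_semiring_prod:
  assumes "nonneg_semiring T" "\<And>a. a \<in> A \<Longrightarrow> P a \<in> T"
  shows "prod P A \<in> T"
  using assms(2)
  by (induction A rule: infinite_finite_induct) (auto intro: nonneg_semiringD[OF assms(1)])

lemma nonneg_semiring_power:
  assumes "nonneg_semiring T" "p \<in> T"
  shows "p ^ n \<in> T"
  using assms(2) by (induction n) (auto intro: nonneg_semiringD[OF assms(1)])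

text \<open>
  Expand \<open>z\<^sup>a (z + (1 - z))\<^bsup>d-a\<^esup>\<close>. The summands with \<open>k < a\<close>
  contribute nothing, since then \<open>k choose a = 0\<close>.
\<close>
lemma power_bernstein_expansion:
  fixes z :: "'v mpoly"
  assumes "a \<le> d"
  shows "z ^ a = (\<Sum>k\<le>d. Const (real (k choose a) / real (d choose a)) *
                      (Const (real (d choose k)) * z ^ k * (1 - z) ^ (d - k)))"
proof -
  have "z ^ a = z ^ a * (z + (1 - z)) ^ (d - a)" by simp
  also have "\<dots> = (\<Sum>i\<le>d - a. of_nat (d - a choose i) * z ^ (a + i) * (1 - z) ^ (d - a - i))"
    by (subst binomial_ring) (simp add: sum_distrib_left power_add mult_ac)
  also have "\<dots> = (\<Sum>k\<in>{a..d}. of_nat (d - a choose (k - a)) * z ^ k * (1 - z) ^ (d - k))"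
    by (rule sum.reindex_bij_witness[of _ "\<lambda>k. k - a" "\<lambda>i. a + i"]) (use assms in auto)
  also have "\<dots> = (\<Sum>k\<in>{a..d}. Const (real (k choose a) / real (d choose a)) *
                      (Const (real (d choose k)) * z ^ k * (1 - z) ^ (d - k)))"
  proof (rule sum.cong)
    fix k assume k: "k \<in> {a..d}"
    have "real (d choose k) * real (k choose a) = real (d choose a) * real (d - a choose (k - a))"
      using choose_mult[of a k d] k by (simp flip: of_nat_mult)
    moreover have "0 < real (d choose a)" using assms by simp
    ultimately have ratio: "real (d - a choose (k - a)) = real (k choose a) / real (d choose a) * real (d choose k)"
      by (simp add: field_simps)
    show "of_nat (d - a choose (k - a)) * z ^ k * (1 - z) ^ (d - k) =
        Const (real (k choose a) / real (d choose a)) * (Const (real (d choose k)) * z ^ k * (1 - z) ^ (d - k))"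
      by (simp only: of_nat_eq_Const ratio Const_mult mult_ac)
  qed simp
  also have "\<dots> = (\<Sum>k\<le>d. Const (real (k choose a) / real (d choose a)) *
                      (Const (real (d choose k)) * z ^ k * (1 - z) ^ (d - k)))"
    by (rule sum.mono_neutral_left) (auto simp: binomial_eq_0)
  finally show ?thesis .
qed

text \<open>
  The ratio is the product of the factors \<open>(k - i)/(d - i)\<close> for \<open>i < a\<close>. As long as \<open>i \<le> k\<close>, the
  factor differs from \<open>k/d\<close> by at most \<open>i/d\<close>; the factor for \<open>i = k\<close> is zero, so that the ratio
  vanishes from then on, while \<open>(k/d)\<^sup>a\<close> can only decrease with \<open>a\<close>. The error is uniform in \<open>k\<close>,
  as needed to choose one degree for all Bernstein coefficients.
\<close>
lemma binomial_ratio_approximates_power: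
  assumes "a \<le> d" "k \<le> d"
  shows "\<bar>real (k choose a) / real (d choose a) - (real k / real d) ^ a\<bar> \<le> real (a\<^sup>2) / real d"
  using assms(1)
proof (induction a)
  case (Suc a)
  define \<beta> where "\<beta> = real (k choose a) / real (d choose a)"
  define s where "s = real k / real d"
  have ad: "a < d" "0 < d" using Suc by auto
  have s: "0 \<le> s" "s \<le> 1" using assms ad by (auto simp: s_def)
  have IH: "\<bar>\<beta> - s ^ a\<bar> \<le> real (a\<^sup>2) / real d" using Suc by (simp add: \<beta>_def s_def)
  have \<beta>: "0 \<le> \<beta>" "\<beta> \<le> 1"
    using ad assms binomial_right_mono[of k d a] by (auto simp: \<beta>_def)
  define \<beta>' where "\<beta>' = real (k choose Suc a) / real (d choose Suc a)"
  have "\<bar>\<beta>' - \<beta> * s\<bar> \<le> real a / real d"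
  proof (cases "k < a")
    case True
    then show ?thesis by (simp add: \<beta>_def \<beta>'_def binomial_eq_0)
  next
    case False
    have step: "real (Suc a) * real (n choose Suc a) = (real n - real a) * real (n choose a)"
      if "a \<le> n" for n
      using binomial_absorb_comp[of n a] binomial_absorption[of a n] that
      by (metis binomial_absorption binomial_absorb_comp of_nat_diff of_nat_mult)
    have d0: "0 < real (d choose a)" "0 < real (d choose Suc a)" using ad by auto
    have "\<beta>' = \<beta> * ((real k - real a) / (real d - real a))"
    proof -
      have "\<beta>' = (real (Suc a) * real (k choose Suc a)) / (real (Suc a) * real (d choose Suc a))"
        by (simp add: \<beta>'_def)
      also have "\<dots> = \<beta> * ((real k - real a) / (real d - real a))"
        using False ad by (subst (1 2) step) (auto simp: \<beta>_def mult.commute)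
      finally show ?thesis .
    qed
    moreover have "\<beta> * r - \<beta> * s = - \<beta> * (s - r)" for r
      by (simp add: algebra_simps)
    ultimately have "\<beta>' - \<beta> * s = - \<beta> * (s - (real k - real a) / (real d - real a))"
      by (simp only:)
    also have "s - (real k - real a) / (real d - real a)
        = (real a / real d) * ((real d - real k) / (real d - real a))"
      using ad by (simp add: s_def field_simps)
    finally have "\<bar>\<beta>' - \<beta> * s\<bar> = \<beta> * ((real a / real d) * ((real d - real k) / (real d - real a)))"
      using \<beta> ad assms by (simp add: abs_mult)
    also have "\<dots> \<le> 1 * ((real a / real d) * 1)"
      using \<beta> ad assms False by (intro mult_mono) auto
    finally show ?thesis by simp
  qed
  moreover have "\<bar>\<beta> * s - s ^ a * s\<bar> \<le> real (a\<^sup>2) / real d"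
  proof -
    have "\<bar>\<beta> * s - s ^ a * s\<bar> = \<bar>\<beta> - s ^ a\<bar> * s" using s by (simp add: abs_mult flip: left_diff_distrib)
    also have "\<dots> \<le> \<bar>\<beta> - s ^ a\<bar> * 1" using s by (intro mult_left_mono) auto
    finally show ?thesis using IH by simp
  qed
  ultimately have "\<bar>\<beta>' - s ^ a * s\<bar> \<le> real a / real d + real (a\<^sup>2) / real d" by linarith
  also have "\<dots> \<le> real ((Suc a)\<^sup>2) / real d"
    using ad by (simp add: power2_eq_square divide_right_mono flip: add_divide_distrib)
  finally show ?case by (simp add: \<beta>'_def s_def mult.commute)
qed simp

text \<open>
  By the previous estimate the coefficient with index \<open>k\<close> differs from the value of \<open>f\<close> at the grid
  point \<open>k/d\<close> of the unit cube by at most \<open>C/d\<close>, where \<open>C\<close> depends only on \<open>f\<close>; and \<open>f\<close> is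
  bounded below by a positive constant on the cube.
\<close>
lemma bernstein_coefficients_nonneg:
  fixes f :: "'v::finite mpoly"
  assumes f: "f \<in> polys_in J"
    and pos: "\<And>x. (\<And>i. i \<in> J \<Longrightarrow> 0 \<le> x $ i \<and> x $ i \<le> 1) \<Longrightarrow> 0 < meval f x"
  obtains d where "\<forall>a\<in>Poly_Mapping.keys f. \<forall>i. Poly_Mapping.lookup a i \<le> d"
    "\<forall>k. (\<forall>i\<in>J. k i \<le> d) \<longrightarrow> 0 \<le> (\<Sum>a\<in>Poly_Mapping.keys f. Poly_Mapping.lookup f a *
        (\<Prod>i\<in>J. real (k i choose Poly_Mapping.lookup a i) / real (d choose Poly_Mapping.lookup a i)))"
proof -
  let ?e = "Poly_Mapping.lookup"
  have "cbox 0 (1 :: real ^ 'v) \<noteq> {}"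
    using mem_box_cart(2)[of 0 0 "1 :: real ^ 'v"] by auto
  then obtain x0 where x0: "x0 \<in> cbox 0 1" "\<And>y. y \<in> cbox 0 1 \<Longrightarrow> meval f x0 \<le> meval f y"
    using continuous_attains_inf[OF compact_cbox _ continuous_on_meval] by blast
  define \<delta> where "\<delta> = meval f x0"
  have \<delta>: "0 < \<delta>" unfolding \<delta>_def using x0(1) by (intro pos) (auto simp: mem_box_cart)
  define C where "C = (\<Sum>a\<in>Poly_Mapping.keys f. \<bar>?e f a\<bar> * (\<Sum>i\<in>J. real ((?e a i)\<^sup>2)))"
  define m where "m = (\<Sum>a\<in>Poly_Mapping.keys f. \<Sum>i\<in>UNIV. ?e a i)"
  define d where "d = max (m + 1) (nat \<lceil>C / \<delta>\<rceil>)"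
  have d: "0 < d" "C / \<delta> \<le> real d" by (auto simp: d_def) linarith+
  have deg: "?e a i \<le> d" if "a \<in> Poly_Mapping.keys f" for a i
  proof -
    have "?e a i \<le> (\<Sum>i\<in>UNIV. ?e a i)" by (rule member_le_sum) auto
    also have "\<dots> \<le> m" unfolding m_def using that by (intro member_le_sum) auto
    finally show ?thesis by (simp add: d_def)
  qed
  have "0 \<le> (\<Sum>a\<in>Poly_Mapping.keys f. ?e f a * (\<Prod>i\<in>J. real (k i choose ?e a i) / real (d choose ?e a i)))"
    if "\<forall>i\<in>J. k i \<le> d" for k
  proof -
    have k: "k i \<le> d" if "i \<in> J" for i using \<open>\<forall>i\<in>J. k i \<le> d\<close> that by blast
    define x :: "real ^ 'v" where "x = (\<chi> i. if i \<in> J then real (k i) / real d else 0)"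
    have "x \<in> cbox 0 1" using k d by (auto simp: mem_box_cart x_def)
    then have "\<delta> \<le> meval f x" unfolding \<delta>_def by (rule x0)
    also have "meval f x = (\<Sum>a\<in>Poly_Mapping.keys f. ?e f a * (\<Prod>i\<in>J. (real (k i) / real d) ^ ?e a i))"
      unfolding meval_monomial_expansion
    proof (intro sum.cong refl arg_cong2[where f = "(*)"])
      fix a assume "a \<in> Poly_Mapping.keys f"
      then have "Poly_Mapping.keys a \<subseteq> J" using f by (auto simp: polys_in_def)
      then show "monomial_value (($) x) a = (\<Prod>i\<in>J. (real (k i) / real d) ^ ?e a i)"
        by (simp add: monomial_value_superset[of J] x_def)
    qed
    finally have lower: "\<delta> \<le> \<dots>" .
    have "\<bar>(\<Sum>a\<in>Poly_Mapping.keys f. ?e f a * (\<Prod>i\<in>J. real (k i choose ?e a i) / real (d choose ?e a i)))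
        - (\<Sum>a\<in>Poly_Mapping.keys f. ?e f a * (\<Prod>i\<in>J. (real (k i) / real d) ^ ?e a i))\<bar>
      \<le> (\<Sum>a\<in>Poly_Mapping.keys f. \<bar>?e f a * (\<Prod>i\<in>J. real (k i choose ?e a i) / real (d choose ?e a i))
           - ?e f a * (\<Prod>i\<in>J. (real (k i) / real d) ^ ?e a i)\<bar>)"
      unfolding sum_subtractf[symmetric] by (rule sum_abs)
    also have "\<dots> \<le> (\<Sum>a\<in>Poly_Mapping.keys f. \<bar>?e f a\<bar> * ((\<Sum>i\<in>J. real ((?e a i)\<^sup>2)) / real d))"
    proof (rule sum_mono)
      fix a assume a: "a \<in> Poly_Mapping.keys f"
      have "norm ((\<Prod>i\<in>J. real (k i choose ?e a i) / real (d choose ?e a i))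
          - (\<Prod>i\<in>J. (real (k i) / real d) ^ ?e a i))
        \<le> (\<Sum>i\<in>J. norm (real (k i choose ?e a i) / real (d choose ?e a i) - (real (k i) / real d) ^ ?e a i))"
      proof (rule norm_prod_diff)
        fix i assume i: "i \<in> J"
        show "norm (real (k i choose ?e a i) / real (d choose ?e a i)) \<le> 1"
          using binomial_right_mono[OF k[OF i], of "?e a i"] deg[OF a] by simp
        show "norm ((real (k i) / real d) ^ ?e a i) \<le> 1"
          using k[OF i] d by (auto intro!: power_le_one)
      qed
      also have "\<dots> \<le> (\<Sum>i\<in>J. real ((?e a i)\<^sup>2) / real d)"
        unfolding real_norm_def
        by (intro sum_mono binomial_ratio_approximates_power deg[OF a] k)
      finally show "\<bar>?e f a * (\<Prod>i\<in>J. real (k i choose ?e a i) / real (d choose ?e a i))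
           - ?e f a * (\<Prod>i\<in>J. (real (k i) / real d) ^ ?e a i)\<bar> \<le>
           \<bar>?e f a\<bar> * ((\<Sum>i\<in>J. real ((?e a i)\<^sup>2)) / real d)"
        unfolding right_diff_distrib[symmetric] abs_mult
        by (intro mult_left_mono) (auto simp: sum_divide_distrib)
    qed
    also have "\<dots> = C / real d" by (simp add: C_def flip: sum_divide_distrib)
    also have "\<dots> \<le> \<delta>" using d \<delta> by (simp add: field_simps)
    finally show ?thesis using lower by linarith
  qed
  with deg show ?thesis by (intro that[of d]) auto
qed

text \<open>
  The Bernstein expansion is an identity of polynomials in \<open>z\<close>, valid in any commutative algebra. So
  it exhibits \<open>f(z)\<close> as a non-negative combination of products of the \<open>z i\<close> and \<open>1 - z i\<close>.
\<close>
lemma positive_on_cube_in_semiring: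
  fixes f :: "'v::finite mpoly" and z :: "'v \<Rightarrow> 'w mpoly"
  assumes f: "f \<in> polys_in J"
    and pos: "\<And>x. (\<And>i. i \<in> J \<Longrightarrow> 0 \<le> x $ i \<and> x $ i \<le> 1) \<Longrightarrow> 0 < meval f x"
    and T: "nonneg_semiring T"
    and z: "\<And>i. i \<in> J \<Longrightarrow> z i \<in> T" "\<And>i. i \<in> J \<Longrightarrow> 1 - z i \<in> T"
  shows "msubst z f \<in> T"
proof -
  let ?e = "Poly_Mapping.lookup"
  obtain d where deg: "\<forall>a\<in>Poly_Mapping.keys f. \<forall>i. ?e a i \<le> d"
    and coeff: "\<forall>k. (\<forall>i\<in>J. k i \<le> d) \<longrightarrow> 0 \<le> (\<Sum>a\<in>Poly_Mapping.keys f. ?e f a *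
        (\<Prod>i\<in>J. real (k i choose ?e a i) / real (d choose ?e a i)))"
    using bernstein_coefficients_nonneg[OF f pos] by blast
  define B where "B k i = Const (real (d choose k)) * z i ^ k * (1 - z i) ^ (d - k)" for k i
  define K where "K = PiE J (\<lambda>_. {..d})"
  have "monomial_value z a = (\<Sum>k\<in>K. Const (\<Prod>i\<in>J. real (k i choose ?e a i) / real (d choose ?e a i))
      * (\<Prod>i\<in>J. B (k i) i))" if a: "a \<in> Poly_Mapping.keys f" for a
  proof -
    have "Poly_Mapping.keys a \<subseteq> J" using f a by (auto simp: polys_in_def)
    then have "monomial_value z a = (\<Prod>i\<in>J. z i ^ ?e a i)"
      by (intro monomial_value_superset) auto
    also have "\<dots> = (\<Prod>i\<in>J. \<Sum>k\<le>d. Const (real (k choose ?e a i) / real (d choose ?e a i)) * B k i)"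
      unfolding B_def by (intro prod.cong power_bernstein_expansion deg[rule_format, OF a] refl)
    also have "\<dots> = (\<Sum>k\<in>K. \<Prod>i\<in>J. Const (real (k i choose ?e a i) / real (d choose ?e a i)) * B (k i) i)"
      unfolding K_def by (intro prod_sum_PiE) auto
    finally show ?thesis by (simp add: prod.distrib Const_prod)
  qed
  then have "msubst z f = (\<Sum>a\<in>Poly_Mapping.keys f. \<Sum>k\<in>K. Const (?e f a) *
      (Const (\<Prod>i\<in>J. real (k i choose ?e a i) / real (d choose ?e a i)) * (\<Prod>i\<in>J. B (k i) i)))"
    unfolding msubst_monomial_expansion sum_distrib_left[symmetric] by (intro sum.cong) auto
  also have "\<dots> = (\<Sum>k\<in>K. Const (\<Sum>a\<in>Poly_Mapping.keys f. ?e f a *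
      (\<Prod>i\<in>J. real (k i choose ?e a i) / real (d choose ?e a i))) * (\<Prod>i\<in>J. B (k i) i))"
    by (subst sum.swap) (simp add: Const_sum Const_mult sum_distrib_right mult.assoc)
  also have "\<dots> \<in> T"
  proof (intro nonneg_semiring_sum[OF T] nonneg_semiringD(3)[OF T] nonneg_semiringD(1)[OF T] coeff[rule_format]
      nonneg_semiring_prod[OF T])
    fix k i assume "k \<in> K" "i \<in> J"
    show "k i \<le> d" using \<open>k \<in> K\<close> \<open>i \<in> J\<close> by (auto simp: K_def)
    show "B (k i) i \<in> T"
      unfolding B_def using z \<open>i \<in> J\<close>
      by (intro nonneg_semiringD(1,3)[OF T] nonneg_semiring_power[OF T]) auto
  qed
  finally show ?thesis .
qed

text \<open>
  The affine change of variables \<open>z\<^sub>i = (x\<^sub>i + N)/(2N)\<close> maps the box \<open>[-N, N]\<close> to the unit cube and turns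
  the bounds \<open>N \<plusminus> x\<^sub>i\<close> into multiples of \<open>z\<^sub>i\<close> and \<open>1 - z\<^sub>i\<close>.
\<close>
lemma positive_on_box_in_semiring:
  fixes F :: "'v::finite mpoly"
  assumes F: "F \<in> polys_in J"
    and pos: "\<And>x. (\<And>i. i \<in> J \<Longrightarrow> \<bar>x $ i\<bar> \<le> N) \<Longrightarrow> 0 < meval F x"
    and T: "nonneg_semiring T" and N: "0 < N"
    and bounds: "\<And>i. i \<in> J \<Longrightarrow> Var i + Const N \<in> T" "\<And>i. i \<in> J \<Longrightarrow> Const N - Var i \<in> T"
  shows "F \<in> T"
proof -
  define w :: "'v \<Rightarrow> 'v mpoly" where "w i = Const (2 * N) * Var i - Const N" for i
  define z :: "'v \<Rightarrow> 'v mpoly" where "z i = Const (1 / (2 * N)) * (Var i + Const N)" for i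
  have half: "Const (1 / (2 * N)) * (Const N + Const N) = 1"
    using N by (simp flip: Const_add Const_mult)
  have "1 - z i = Const (1 / (2 * N)) * ((Const N + Const N) - (Var i + Const N))" for i
    unfolding right_diff_distrib half z_def by simp
  then have z': "1 - z i = Const (1 / (2 * N)) * (Const N - Var i)" for i by simp
  have "msubst z (w i) = Var i" for i
  proof -
    have "msubst z (w i) = Const (2 * N) * Const (1 / (2 * N)) * (Var i + Const N) - Const N"
      by (simp add: w_def z_def mult.assoc)
    also have "\<dots> = Var i" using N by (simp flip: Const_mult)
    finally show ?thesis .
  qed
  then have "F = msubst z (msubst w F)"
    unfolding msubst_msubst by (intro msubst_Var[OF F, symmetric])
  also have "\<dots> \<in> T"
  proof (rule positive_on_cube_in_semiring[OF _ _ T])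
    show "msubst w F \<in> polys_in J"
      unfolding w_def by (intro polys_in_msubst[OF F] polys_in_diff polys_in_mult Var_in_polys_in) auto
    show "0 < meval (msubst w F) x" if x: "\<And>i. i \<in> J \<Longrightarrow> 0 \<le> x $ i \<and> x $ i \<le> 1" for x
      unfolding meval_msubst
    proof (rule pos)
      fix i assume "i \<in> J"
      then have "0 \<le> N * x $ i" "N * x $ i \<le> N * 1"
        using x N by (auto intro!: mult_left_mono)
      then show "\<bar>(\<chi> i. meval (w i) x) $ i\<bar> \<le> N" by (simp add: w_def)
    qed
    show "z i \<in> T" "1 - z i \<in> T" if "i \<in> J" for i
      unfolding z' unfolding z_def
      using N bounds that by (auto intro!: nonneg_semiringD(1,3)[OF T])
  qed
  finally show ?thesis .
qed

section \<open>Polynomials positive on a single ball\<close>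

definition nonneg_coeff_polys :: "('v \<Rightarrow>\<^sub>0 nat) set \<Rightarrow> 'v mpoly set" where
  "nonneg_coeff_polys M = {p. (\<forall>a. 0 \<le> Poly_Mapping.lookup p a) \<and> Poly_Mapping.keys p \<subseteq> M}"

definition even_exponents :: "'v set \<Rightarrow> ('v \<Rightarrow>\<^sub>0 nat) set" where
  "even_exponents W = {a. Poly_Mapping.keys a \<subseteq> W \<and> (\<forall>i. even (Poly_Mapping.lookup a i))}"

lemma nonneg_semiring_nonneg_coeff_polys:
  assumes "0 \<in> M" "\<And>a b. a \<in> M \<Longrightarrow> b \<in> M \<Longrightarrow> a + b \<in> M"
  shows "nonneg_semiring (nonneg_coeff_polys M)"
  unfolding nonneg_semiring_def
proof (intro conjI allI ballI impI)
  fix c :: real assume "0 \<le> c"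
  then show "Const c \<in> nonneg_coeff_polys M"
    using assms by (auto simp: nonneg_coeff_polys_def Const_def lookup_single when_def split: if_splits)
next
  fix p q assume "p \<in> nonneg_coeff_polys M" "q \<in> nonneg_coeff_polys M"
  then show "p + q \<in> nonneg_coeff_polys M"
    using keys_add[of p q] by (auto simp: nonneg_coeff_polys_def lookup_add)
next
  fix p q assume pq: "p \<in> nonneg_coeff_polys M" "q \<in> nonneg_coeff_polys M"
  let ?s = "\<lambda>p. \<Sum>a\<in>Poly_Mapping.keys p. Poly_Mapping.single a (Poly_Mapping.lookup p a)"
  have "p * q = ?s p * ?s q" by (simp flip: poly_mapping_sum_singles)
  then have "0 \<le> Poly_Mapping.lookup (p * q) a" for a
    using pq by (auto simp: sum_product mult_single lookup_sum lookup_single when_def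
        nonneg_coeff_polys_def intro!: sum_nonneg)
  moreover have "Poly_Mapping.keys (p * q) \<subseteq> M"
  proof
    fix c assume "c \<in> Poly_Mapping.keys (p * q)"
    then obtain a b where "c = a + b" "a \<in> Poly_Mapping.keys p" "b \<in> Poly_Mapping.keys q"
      using keys_mult[of p q] by blast
    moreover from this have "a \<in> M" "b \<in> M" using pq by (auto simp: nonneg_coeff_polys_def)
    ultimately show "c \<in> M" using assms(2) by blast
  qed
  ultimately show "p * q \<in> nonneg_coeff_polys M" by (simp add: nonneg_coeff_polys_def)
qed

lemma nonneg_semiring_even: "nonneg_semiring (nonneg_coeff_polys (even_exponents W))"
proof (rule nonneg_semiring_nonneg_coeff_polys)
  fix a b :: "'a \<Rightarrow>\<^sub>0 nat" assume "a \<in> even_exponents W" "b \<in> even_exponents W"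
  then show "a + b \<in> even_exponents W"
    using keys_add[of a b] by (auto simp: even_exponents_def lookup_add)
qed (simp add: even_exponents_def)

lemma even_power_in_nonneg_coeff_polys:
  assumes "i \<in> W" "0 \<le> c"
  shows "Poly_Mapping.single (Poly_Mapping.single i (2 * n)) c \<in> nonneg_coeff_polys (even_exponents W)"
  using assms
  by (auto simp: nonneg_coeff_polys_def even_exponents_def lookup_single when_def split: if_splits)

lemma Var_square_in_nonneg_coeff_polys:
  assumes "i \<in> W" shows "(Var i)\<^sup>2 \<in> nonneg_coeff_polys (even_exponents W)"
proof -
  have "(Var i)\<^sup>2 = Poly_Mapping.single (Poly_Mapping.single i (2 * 1)) (1::real)"
    by (simp add: Var_def power2_eq_square mult_single numeral_2_eq_2 flip: single_add)
  then show ?thesis using even_power_in_nonneg_coeff_polys[OF assms, of 1 1] by simp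
qed

text \<open>
  The polynomials of the form required of the summand of one clique in part (i), with \<open>\<alpha>\<^sub>0, \<alpha>\<^sub>1\<close>
  restricted to even exponents and non-negative coefficients. Allowing both \<open>\<alpha>\<^sub>0\<close> and \<open>\<alpha>\<^sub>1 u\<close> amounts
  to allowing all powers of \<open>u\<close>, and makes this set closed under multiplication.
\<close>
definition ball_semiring :: "'n set \<Rightarrow> real \<Rightarrow> 'n mpoly set" where
  "ball_semiring J r = {yzu_subst J r a + yzu_subst J r b * ball_poly J r | a b.
     a \<in> nonneg_coeff_polys (even_exponents (yzu_vars J)) \<and>
     b \<in> nonneg_coeff_polys (even_exponents (yzu_vars J))}"

lemma nonneg_semiring_ball_semiring: "nonneg_semiring (ball_semiring J r)"
proof -
  let ?E = "nonneg_coeff_polys (even_exponents (yzu_vars J))"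
  note E = nonneg_semiringD[OF nonneg_semiring_even[of "yzu_vars J"]]
  have I: "p \<in> ball_semiring J r"
    if "a \<in> ?E" "b \<in> ?E" "p = yzu_subst J r a + yzu_subst J r b * ball_poly J r" for p a b
    using that by (auto simp: ball_semiring_def)
  show ?thesis
    unfolding nonneg_semiring_def
  proof (intro conjI allI ballI impI)
    fix c :: real assume "0 \<le> c"
    then show "Const c \<in> ball_semiring J r"
      by (intro I[of "Const c" 0] E) (auto simp: yzu_subst_def)
  next
    fix p q assume "p \<in> ball_semiring J r" "q \<in> ball_semiring J r"
    then obtain a b c d where abcd: "a \<in> ?E" "b \<in> ?E" "c \<in> ?E" "d \<in> ?E"
      and pq: "p = yzu_subst J r a + yzu_subst J r b * ball_poly J r"
        "q = yzu_subst J r c + yzu_subst J r d * ball_poly J r"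
      by (auto simp: ball_semiring_def)
    show "p + q \<in> ball_semiring J r"
      by (rule I[of "a + c" "b + d"])
        (use abcd in \<open>auto intro: E simp: pq yzu_subst_def algebra_simps\<close>)
    have "(Var UVar)\<^sup>2 \<in> ?E"
      by (intro Var_square_in_nonneg_coeff_polys) (simp add: yzu_vars_def)
    then show "p * q \<in> ball_semiring J r"
      using abcd
      by (intro I[of "a * c + b * d * (Var UVar)\<^sup>2" "a * d + b * c"] E)
        (auto simp: pq yzu_subst_def power2_eq_square algebra_simps)
  qed
qed

lemma ball_poly_in_ball_semiring: "ball_poly J r \<in> ball_semiring J r"
proof -
  have "ball_poly J r = yzu_subst J r 0 + yzu_subst J r 1 * ball_poly J r"
    by (simp add: yzu_subst_def)
  then show ?thesis
    unfolding ball_semiring_def using nonneg_semiringD(4,5)[OF nonneg_semiring_even] by blast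
qed

lemma squares_in_ball_semiring:
  assumes "i \<in> J"
  shows "(Var i + Const r)\<^sup>2 \<in> ball_semiring J r" "(Const r - Var i)\<^sup>2 \<in> ball_semiring J r"
proof -
  have *: "yzu_subst J r ((Var v)\<^sup>2) \<in> ball_semiring J r" if "v \<in> yzu_vars J" for v
  proof -
    have "yzu_subst J r ((Var v)\<^sup>2) = yzu_subst J r ((Var v)\<^sup>2) + yzu_subst J r 0 * ball_poly J r"
      by (simp add: yzu_subst_def)
    then show ?thesis
      unfolding ball_semiring_def
      using nonneg_semiringD(4)[OF nonneg_semiring_even] Var_square_in_nonneg_coeff_polys[OF that] by blast
  qed
  show "(Var i + Const r)\<^sup>2 \<in> ball_semiring J r"
    using *[of "YVar i"] assms by (simp add: yzu_vars_def yzu_subst_def)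
  show "(Const r - Var i)\<^sup>2 \<in> ball_semiring J r"
    using *[of "ZVar i"] assms by (simp add: yzu_vars_def yzu_subst_def)
qed

lemma half_sum_of_squares:
  "Const (1 / 2) * ((v + c)\<^sup>2 + (c - v)\<^sup>2) = v\<^sup>2 + (c\<^sup>2 :: 'v mpoly)"
proof -
  have "Const (1 / 2) * (2 :: 'v mpoly) = Const (1 / 2) * Const 2"
    by (simp add: Const_def)
  also have "\<dots> = 1" by (simp flip: Const_mult)
  finally have half: "Const (1 / 2) * (2 :: 'v mpoly) = 1" .
  have "(v + c)\<^sup>2 + (c - v)\<^sup>2 = 2 * (v\<^sup>2 + c\<^sup>2)"
    by (simp add: power2_eq_square algebra_simps)
  then have "Const (1 / 2) * ((v + c)\<^sup>2 + (c - v)\<^sup>2) = Const (1 / 2) * 2 * (v\<^sup>2 + c\<^sup>2)"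
    by (simp only: mult.assoc)
  then show ?thesis by (simp only: half mult_1_left)
qed

text \<open>
  Each summand \<open>x\<^sub>j\<^sup>2 + r\<^sup>2\<close> is half the sum of the squares of \<open>r + x\<^sub>j\<close> and \<open>r - x\<^sub>j\<close>.
\<close>
lemma norm_square_in_ball_semiring:
  assumes "finite J" "A \<subseteq> J"
  shows "(\<Sum>j\<in>A. (Var j)\<^sup>2) + Const (real (card A) * r\<^sup>2) \<in> ball_semiring J r"
proof -
  note T = nonneg_semiring_ball_semiring[of J r]
  have "(\<Sum>j\<in>A. (Var j)\<^sup>2) + Const (real (card A) * r\<^sup>2)
      = (\<Sum>j\<in>A. Const (1 / 2) * ((Var j + Const r)\<^sup>2 + (Const r - Var j)\<^sup>2))"
  proof -
    have "Const (real (card A) * r\<^sup>2) = (\<Sum>j\<in>A. (Const r)\<^sup>2 :: 'a mpoly)"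
      by (simp add: of_nat_eq_Const Const_mult Const_power)
    then show ?thesis by (simp add: half_sum_of_squares sum.distrib)
  qed
  also have "\<dots> \<in> ball_semiring J r"
    using assms
    by (intro nonneg_semiring_sum[OF T] nonneg_semiringD(1-3)[OF T] squares_in_ball_semiring) auto
  finally show ?thesis .
qed

text \<open>
  In \<open>(r \<plusminus> x\<^sub>i)\<^sup>2 + (r\<^sup>2 - \<parallel>x\<parallel>\<^sup>2)\<close> the square of \<open>x\<^sub>i\<close> cancels; the squares of the other coordinates are
  cancelled by \<open>P\<close>, the sum of \<open>x\<^sub>j\<^sup>2 + r\<^sup>2\<close> over \<open>j \<noteq> i\<close>. What remains is \<open>\<plusminus>2 r x\<^sub>i + (n + 1) r\<^sup>2\<close>,
  with \<open>n\<close> the cardinality of \<open>J\<close>.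
\<close>
lemma coordinate_bounds_in_ball_semiring:
  assumes J: "finite J" "i \<in> J" and r: "0 < r"
  defines "N \<equiv> (real (card J) + 1) * r / 2"
  shows "Var i + Const N \<in> ball_semiring J r" "Const N - Var i \<in> ball_semiring J r"
proof -
  note T = nonneg_semiring_ball_semiring[of J r]
  define P where "P = (\<Sum>j\<in>J - {i}. (Var j)\<^sup>2) + Const (real (card (J - {i})) * r\<^sup>2)"
  have P: "P \<in> ball_semiring J r"
    unfolding P_def using J by (intro norm_square_in_ball_semiring) auto
  have card: "real (card J) = real (card (J - {i})) + 1"
    by (subst card.remove[OF J]) simp
  have "ball_poly J r + P = Const (r\<^sup>2) + Const (real (card (J - {i})) * r\<^sup>2) - (Var i)\<^sup>2"
    unfolding ball_poly_def P_def sum.remove[OF J] by simp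
  also have "\<dots> = Const (real (card J) * r\<^sup>2) - (Var i)\<^sup>2"
    unfolding card by (simp add: Const_add distrib_right)
  finally have sum_eq: "ball_poly J r + P = Const (real (card J) * r\<^sup>2) - (Var i)\<^sup>2" .
  have scale: "Const (1 / (2 * r)) * (Const (2 * r) * v + (Const (real (card J) * r\<^sup>2) + Const (r\<^sup>2))) = v + Const N"
    for v :: "'a mpoly"
  proof -
    have "Const (1 / (2 * r)) * (Const (2 * r) * v) = v"
      using r by (simp flip: Const_mult mult.assoc)
    moreover have "1 / (2 * r) * (real (card J) * r\<^sup>2 + r\<^sup>2) = N"
      using r by (simp add: N_def field_simps power2_eq_square)
    then have "Const (1 / (2 * r)) * (Const (real (card J) * r\<^sup>2) + Const (r\<^sup>2)) = (Const N :: 'a mpoly)"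
      by (simp only: Const_mult[symmetric] Const_add[symmetric])
    ultimately show ?thesis by (simp only: distrib_left)
  qed
  have double: "Const (2 * r) = (Const r + Const r :: 'a mpoly)" by (simp flip: Const_add)
  have "(Var i + Const r)\<^sup>2 + (ball_poly J r + P)
      = Const (2 * r) * Var i + (Const (real (card J) * r\<^sup>2) + Const (r\<^sup>2))"
    unfolding sum_eq double by (simp add: Const_mult power2_eq_square algebra_simps)
  then have "Var i + Const N = Const (1 / (2 * r)) * ((Var i + Const r)\<^sup>2 + (ball_poly J r + P))"
    by (simp only: scale)
  also have "\<dots> \<in> ball_semiring J r"
    using r J P by (intro nonneg_semiringD(1-3)[OF T] squares_in_ball_semiring ball_poly_in_ball_semiring) auto
  finally show "Var i + Const N \<in> ball_semiring J r" .
  have "(Const r - Var i)\<^sup>2 + (ball_poly J r + P)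
      = Const (2 * r) * (- Var i) + (Const (real (card J) * r\<^sup>2) + Const (r\<^sup>2))"
    unfolding sum_eq double by (simp add: Const_mult power2_eq_square algebra_simps)
  then have "- Var i + Const N = Const (1 / (2 * r)) * ((Const r - Var i)\<^sup>2 + (ball_poly J r + P))"
    by (simp only: scale)
  also have "\<dots> \<in> ball_semiring J r"
    using r J P by (intro nonneg_semiringD(1-3)[OF T] squares_in_ball_semiring ball_poly_in_ball_semiring) auto
  finally show "Const N - Var i \<in> ball_semiring J r" by simp
qed

text \<open>
  On the box \<open>[-N, N]\<close> the ball is described by the single constraint \<open>u \<ge> 0\<close>. Removing it
  subtracts \<open>(1 - u/U)\<^bsup>2n\<^esup> u\<close>, which belongs to the semiring, and leaves a polynomial \<open>F\<close> positive on the
  box. The constant \<open>U\<close>, which is at least the maximum \<open>r\<^sup>2\<close> of \<open>u\<close>, is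
  chosen to make \<open>U - u\<close> an element of the semiring.
\<close>
lemma positive_on_ball_in_ball_semiring:
  fixes q :: "'n::finite mpoly"
  assumes q: "q \<in> polys_in J" and r: "0 < r"
    and pos: "\<And>x. L2_set (($) x) J \<le> r \<Longrightarrow> 0 < meval q x"
  shows "q \<in> ball_semiring J r"
proof -
  note T = nonneg_semiring_ball_semiring[of J r]
  define N where "N = (real (card J) + 1) * r / 2"
  define U where "U = (real (card J) + 1) * r\<^sup>2"
  have N: "0 < N" and U: "0 < U" using r by (auto simp: N_def U_def add_nonneg_pos)
  obtain n :: nat where n: "\<And>x. x \<in> cbox (- (\<chi> i. N)) (\<chi> i. N) \<Longrightarrow> 0 < meval q x -
      (\<Sum>j\<in>{()}. ((U - meval (ball_poly J r) x) / U) ^ (2 * n) * meval (ball_poly J r) x)"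
  proof (rule eliminate_constraints[of "cbox (- (\<chi> i. N)) (\<chi> i. N)" "meval q" "{()}" "\<lambda>_. meval (ball_poly J r)" "\<lambda>_. U"])
    show "meval (ball_poly J r) x \<le> U" for x
    proof -
      have "meval (ball_poly J r) x \<le> r\<^sup>2" by (simp add: meval_ball_poly)
      also have "\<dots> \<le> U" unfolding U_def using mult_right_mono[of 1 "real (card J) + 1" "r\<^sup>2"] by simp
      finally show ?thesis .
    qed
    show "0 < meval q x" if "\<And>j. j \<in> {()} \<Longrightarrow> 0 \<le> meval (ball_poly J r) x" for x
    proof (rule pos)
      have "(L2_set (($) x) J)\<^sup>2 \<le> r\<^sup>2" using that by (simp add: meval_ball_poly)
      then show "L2_set (($) x) J \<le> r" by (rule power2_le_imp_le) (use r in simp)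
    qed
  qed (use U in \<open>auto intro: continuous_on_meval\<close>)
  define u where "u = ball_poly J r"
  define w where "w = Const (1 / U) * (Const U - u)"
  define F where "F = q - w ^ (2 * n) * u"
  have "u \<in> polys_in J" by (simp add: u_def ball_poly_in_polys_in)
  then have "w \<in> polys_in J"
    unfolding w_def by (intro polys_in_mult polys_in_diff Const_in_polys_in)
  have "F \<in> polys_in J"
    unfolding F_def by (intro polys_in_diff polys_in_mult polys_in_power) fact+
  then have "F \<in> ball_semiring J r"
  proof (rule positive_on_box_in_semiring[OF _ _ T N])
    fix x :: "real ^ 'n" assume x: "\<And>i. i \<in> J \<Longrightarrow> \<bar>x $ i\<bar> \<le> N"
    have "coord_proj J x \<in> cbox (- (\<chi> i. N)) (\<chi> i. N)"
      unfolding mem_box_cart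
    proof
      fix i
      show "(- (\<chi> i. N)) $ i \<le> coord_proj J x $ i \<and> coord_proj J x $ i \<le> (\<chi> i. N) $ i"
        using x[of i] N by (auto simp: coord_proj_def)
    qed
    from n[OF this] have "0 < meval F (coord_proj J x)" by (simp add: F_def w_def u_def)
    also have "meval F (coord_proj J x) = meval F x"
      by (rule meval_cong[OF \<open>F \<in> polys_in J\<close>]) (simp add: coord_proj_def)
    finally show "0 < meval F x" .
  qed (use coordinate_bounds_in_ball_semiring[of J _ r] r in \<open>simp_all add: N_def\<close>)
  moreover have "Const U - u = (\<Sum>j\<in>J. (Var j)\<^sup>2) + Const (real (card J) * r\<^sup>2)"
    by (simp add: U_def u_def ball_poly_def algebra_simps Const_add)
  then have "Const U - u \<in> ball_semiring J r"
    using norm_square_in_ball_semiring[of J J r] by simp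
  then have "w \<in> ball_semiring J r"
    unfolding w_def using U by (intro nonneg_semiringD(1,3)[OF T]) auto
  ultimately have "F + w ^ (2 * n) * u \<in> ball_semiring J r"
    using ball_poly_in_ball_semiring[of J r] unfolding u_def
    by (intro nonneg_semiringD(2,3)[OF T] nonneg_semiring_power[OF T])
  then show ?thesis by (simp add: F_def)
qed

section \<open>The four polynomial classes\<close>

lemma sum_in_finite_sums:
  assumes "finite A" "\<And>a. a \<in> A \<Longrightarrow> f a \<in> S"
  shows "sum f A \<in> finite_sums S"
proof -
  obtain xs where "set xs = A" "distinct xs" using finite_distinct_list[OF assms(1)] by blast
  then have "sum f A = sum_list (map f xs)" "set (map f xs) \<subseteq> S"
    using assms(2) by (auto simp: sum_list_distinct_conv_sum_set)
  then show ?thesis unfolding finite_sums_def by blast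
qed

lemma monomial_value_nonneg:
  fixes x :: "'v \<Rightarrow> real"
  assumes "\<And>i. i \<in> Poly_Mapping.keys a \<Longrightarrow> 0 \<le> x i \<or> even (Poly_Mapping.lookup a i)"
  shows "0 \<le> monomial_value x a"
  unfolding monomial_value_def
proof (rule prod_nonneg)
  fix i assume "i \<in> Poly_Mapping.keys a"
  from assms[OF this] show "0 \<le> x i ^ Poly_Mapping.lookup a i"
    by (auto simp: zero_le_even_power)
qed

lemma even_exponent_half:
  assumes "a \<in> even_exponents W"
  obtains b where "a = b + b" "Poly_Mapping.keys b \<subseteq> W"
proof -
  define b where "b = (\<Sum>i\<in>Poly_Mapping.keys a. Poly_Mapping.single i (Poly_Mapping.lookup a i div 2))"
  have b: "Poly_Mapping.lookup b i = Poly_Mapping.lookup a i div 2" for i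
    by (auto simp: b_def lookup_sum lookup_single when_def in_keys_iff)
  show ?thesis
  proof (rule that[of b])
    show "a = b + b"
      using assms by (intro poly_mapping_eqI) (auto simp: lookup_add b even_exponents_def simp flip: mult_2)
    have "Poly_Mapping.keys b \<subseteq> Poly_Mapping.keys a"
      using b by (auto simp: in_keys_iff)
    then show "Poly_Mapping.keys b \<subseteq> W" using assms by (auto simp: even_exponents_def)
  qed
qed

text \<open>
  Each monomial \<open>c w\<^bsup>2\<beta>\<^esup>\<close> is the square of a binomial with two equal terms \<open>\<surd>c/2 w\<^sup>\<beta>\<close>.
\<close>
lemma nonneg_even_in_dsos:
  assumes "p \<in> nonneg_coeff_polys (even_exponents W)"
  shows "p \<in> dsos W"
proof -
  let ?K = "Poly_Mapping.keys p"
  obtain e where e: "bij_betw e {1..card ?K} ?K"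
    using ex_bij_betw_nat_finite_1[of ?K] by auto
  have "\<exists>b. a = b + b \<and> Poly_Mapping.keys b \<subseteq> W" if "a \<in> ?K" for a
    using assms that by (auto simp: nonneg_coeff_polys_def intro: even_exponent_half[of a W])
  then obtain half where half: "\<And>a. a \<in> ?K \<Longrightarrow> a = half a + half a \<and> Poly_Mapping.keys (half a) \<subseteq> W"
    by metis
  define s where "s l = sqrt (Poly_Mapping.lookup p (e l)) / 2" for l
  define \<alpha> where "\<alpha> l = half (e l)" for l
  have e_in: "e l \<in> ?K" if "l \<in> {1..card ?K}" for l using bij_betwE[OF e] that by blast
  have square: "Poly_Mapping.single (e l) (Poly_Mapping.lookup p (e l))
      = (Poly_Mapping.single (\<alpha> l) (s l) + Poly_Mapping.single (\<alpha> l) (s l))\<^sup>2"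
    if "l \<in> {1..card ?K}" for l
  proof -
    have "s l + s l = sqrt (Poly_Mapping.lookup p (e l))" by (simp add: s_def)
    moreover have "0 \<le> Poly_Mapping.lookup p (e l)"
      using assms by (simp add: nonneg_coeff_polys_def)
    ultimately have "(s l + s l) * (s l + s l) = Poly_Mapping.lookup p (e l)" by simp
    moreover have "\<alpha> l + \<alpha> l = e l" using half[OF e_in[OF that]] by (simp add: \<alpha>_def)
    ultimately show ?thesis
      unfolding power2_eq_square single_add[symmetric] mult_single by simp
  qed
  have "p = (\<Sum>a\<in>?K. Poly_Mapping.single a (Poly_Mapping.lookup p a))"
    by (rule poly_mapping_sum_singles)
  also have "\<dots> = (\<Sum>l=1..card ?K. Poly_Mapping.single (e l) (Poly_Mapping.lookup p (e l)))"
    by (rule sum.reindex_bij_betw[OF e, symmetric])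
  also have "\<dots> = (\<Sum>l=1..card ?K. (Poly_Mapping.single (\<alpha> l) (s l) + Poly_Mapping.single (\<alpha> l) (s l))\<^sup>2)"
    by (intro sum.cong square) auto
  finally have eq: "p = \<dots>" .
  have "\<forall>l\<in>{1..card ?K}. Poly_Mapping.keys (\<alpha> l) \<subseteq> W \<and> Poly_Mapping.keys (\<alpha> l) \<subseteq> W"
    using half e_in by (simp add: \<alpha>_def)
  moreover have "\<forall>l\<in>{1..card ?K}. s l = s l \<or> s l = - s l" by simp
  ultimately show ?thesis unfolding dsos_def using eq by blast
qed

lemma dsos_subset_sdsos: "dsos W \<subseteq> sdsos W"
  unfolding dsos_def sdsos_def by blast

text \<open>
  Each monomial with an even exponent \<open>a\<close> is a circuit polynomial whose simplex is the point \<open>a\<close>, with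
  \<open>\<beta> = a\<close> and \<open>d = 0\<close>.
\<close>
lemma nonneg_even_in_sonc:
  fixes W :: "'v::finite set"
  assumes "p \<in> nonneg_coeff_polys (even_exponents W)"
  shows "p \<in> sonc W"
proof -
  let ?f = "\<lambda>a. Poly_Mapping.single a (Poly_Mapping.lookup p a)"
  have "sum ?f (Poly_Mapping.keys p) \<in> sonc W"
    unfolding sonc_def
  proof (intro sum_in_finite_sums CollectI conjI allI finite_keys)
    fix a assume a: "a \<in> Poly_Mapping.keys p"
    have c: "0 \<le> Poly_Mapping.lookup p a" "a \<in> even_exponents W"
      using assms a by (auto simp: nonneg_coeff_polys_def)
    have "0 < Poly_Mapping.lookup p a" using c a by (simp add: in_keys_iff)
    then show "circuit_poly W (?f a)"
      unfolding circuit_poly_def using c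
      by (intro exI[of _ "{a}"] exI[of _ "\<lambda>_. Poly_Mapping.lookup p a"] exI[of _ 0] exI[of _ a])
         (simp add: even_exponents_def rel_interior_sing)
    show "0 \<le> meval (?f a) x" for x
      using c by (auto simp: even_exponents_def intro!: mult_nonneg_nonneg monomial_value_nonneg)
  qed
  then show ?thesis by (simp flip: poly_mapping_sum_singles)
qed

lemma nonneg_in_sag:
  fixes W :: "'v::finite set"
  assumes "p \<in> nonneg_coeff_polys {a. Poly_Mapping.keys a \<subseteq> W}"
  shows "p \<in> sag W"
proof -
  have nonneg: "0 \<le> Poly_Mapping.lookup p a" for a using assms by (simp add: nonneg_coeff_polys_def)
  have "amgm_poly W p"
    unfolding amgm_poly_def
  proof (intro conjI allI impI)
    show W: "p \<in> polys_in W" using assms by (auto simp: nonneg_coeff_polys_def polys_in_def)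
    show "0 \<le> meval p x" if "\<forall>i\<in>W. 0 \<le> x $ i" for x
      unfolding meval_monomial_expansion
    proof (intro sum_nonneg mult_nonneg_nonneg nonneg monomial_value_nonneg disjI1)
      fix a i assume "a \<in> Poly_Mapping.keys p" "i \<in> Poly_Mapping.keys a"
      then show "0 \<le> x $ i" using W that unfolding polys_in_def by blast
    qed
    have "{a \<in> Poly_Mapping.keys p. Poly_Mapping.lookup p a < 0} = {}"
      using nonneg by (auto simp: not_less)
    then show "card {a \<in> Poly_Mapping.keys p. Poly_Mapping.lookup p a < 0} \<le> 1"
      by (simp only: card.empty zero_le_one)
  qed
  then show ?thesis
    unfolding sag_def using sum_in_finite_sums[of "{()}" "\<lambda>_. p" "{q. amgm_poly W q}"] by simp
qed

lemma nonneg_coeff_polys_mono: "M \<subseteq> M' \<Longrightarrow> nonneg_coeff_polys M \<subseteq> nonneg_coeff_polys M'"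
  by (auto simp: nonneg_coeff_polys_def)

lemma nonneg_even_in_class:
  fixes W :: "'v::finite set"
  assumes p: "p \<in> nonneg_coeff_polys (even_exponents W)"
  shows "p \<in> class_polys K W"
proof (cases K)
  case SONC
  then show ?thesis using nonneg_even_in_sonc[OF p] by simp
next
  case SDSOS
  then show ?thesis using nonneg_even_in_dsos[OF p] dsos_subset_sdsos by auto
next
  case DSOS
  then show ?thesis using nonneg_even_in_dsos[OF p] by simp
next
  case SAG
  have "even_exponents W \<subseteq> {a. Poly_Mapping.keys a \<subseteq> W}" by (auto simp: even_exponents_def)
  from nonneg_coeff_polys_mono[OF this] p show ?thesis
    using SAG nonneg_in_sag[of p W] by auto
qed

lemma nonneg_even_plus_var_in_sag:
  fixes W :: "'v::finite set"
  assumes "a \<in> nonneg_coeff_polys (even_exponents W)" "b \<in> nonneg_coeff_polys (even_exponents W)" "v \<in> W"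
  shows "a + b * Var v \<in> sag W"
proof -
  let ?M = "{a. Poly_Mapping.keys a \<subseteq> W}"
  have T: "nonneg_semiring (nonneg_coeff_polys ?M)"
  proof (rule nonneg_semiring_nonneg_coeff_polys)
    show "a + b \<in> ?M" if "a \<in> ?M" "b \<in> ?M" for a b
      using that keys_add[of a b] by blast
  qed simp
  have "even_exponents W \<subseteq> ?M" by (auto simp: even_exponents_def)
  then have "a \<in> nonneg_coeff_polys ?M" "b \<in> nonneg_coeff_polys ?M"
    using assms nonneg_coeff_polys_mono by blast+
  moreover have "Var v \<in> nonneg_coeff_polys ?M"
    using assms by (auto simp: nonneg_coeff_polys_def Var_def lookup_single when_def)
  ultimately show ?thesis
    by (intro nonneg_in_sag nonneg_semiringD(2,3)[OF T])
qed

section \<open>The sparse certificates\<close>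

theorem corollary2:
  fixes k m :: nat
    and I :: "nat \<Rightarrow> 'n::finite set"
    and R U :: "nat \<Rightarrow> real"
    and ell :: "nat \<Rightarrow> nat"
    and g :: "nat \<Rightarrow> 'n mpoly"
    and p :: "'n mpoly"
  assumes cover: "k_cover k I"
    and rip: "RIP k I"
    and R_pos: "\<forall>l\<in>{1..k}. R l > 0"
    and ell: "\<forall>j\<in>{1..m}. ell j \<in> {1..k}"
    and g: "\<forall>j\<in>{1..m}. g j \<in> polys_in (I (ell j))"
    and U_pos: "\<forall>j\<in>{1..m}. U j > 0"
    and U_max: "\<forall>j\<in>{1..m}. \<forall>x. L2_set (($) x) (I (ell j)) \<le> R (ell j) \<longrightarrow> meval (g j) x \<le> U j"
    and sparse: "sparse_poly k I p"
    and pos: "\<forall>x\<in>sparse_ball k I R. (\<forall>j\<in>{1..m}. meval (g j) x \<ge> 0) \<longrightarrow> meval p x > 0"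
  shows
    "(\<forall>K. \<exists>(\<alpha> :: nat \<Rightarrow> nat \<Rightarrow> 'n yzu mpoly) (\<rho> :: nat \<Rightarrow> unit mpoly).
        (\<forall>j\<in>{0, 1}. \<forall>l\<in>{1..k}. \<alpha> j l \<in> class_polys K (yzu_vars (I l))) \<and>
        (\<forall>j\<in>{1..m}. \<rho> j \<in> class_polys K UNIV) \<and>
        p = (\<Sum>l=1..k. yzu_subst (I l) (R l) (\<alpha> 0 l)
                       + yzu_subst (I l) (R l) (\<alpha> 1 l) * ball_poly (I l) (R l))
            + (\<Sum>j=1..m. usubst (Const (U j) - g j) (\<rho> j) * g j))
     \<and>
     (\<exists>(\<alpha> :: nat \<Rightarrow> 'n yzu mpoly) (\<rho> :: nat \<Rightarrow> unit mpoly).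
        (\<forall>l\<in>{1..k}. \<alpha> l \<in> sag (yzu_vars (I l))) \<and>
        (\<forall>j\<in>{1..m}. \<rho> j \<in> sag UNIV) \<and>
        p = (\<Sum>l=1..k. yzu_subst (I l) (R l) (\<alpha> l))
            + (\<Sum>j=1..m. usubst (Const (U j) - g j) (\<rho> j) * g j))"
proof -
  have "k \<noteq> 0" using cover by (auto simp: k_cover_def)
  then have k: "1 \<le> k" by simp
  have "compact (sparse_ball k I R)"
    using compact_coordinate_balls[of "{1..k}" I R] cover
    unfolding sparse_ball_def k_cover_def by (simp del: UN_iff One_nat_def)
  then obtain N where N: "\<And>x. x \<in> sparse_ball k I R \<Longrightarrow>
      0 < meval p x - (\<Sum>j\<in>{1..m}. ((U j - meval (g j) x) / U j) ^ (2 * N) * meval (g j) x)"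
  proof (rule eliminate_constraints[of _ "meval p" "{1..m}" "\<lambda>j. meval (g j)" U])
    show "meval (g j) x \<le> U j" if "j \<in> {1..m}" "x \<in> sparse_ball k I R" for j x
      using U_max ell that by (simp add: sparse_ball_def)
    show "0 < meval p x" if "x \<in> sparse_ball k I R" "\<And>j. j \<in> {1..m} \<Longrightarrow> 0 \<le> meval (g j) x" for x
      using pos that by blast
  qed (use U_pos in \<open>auto intro: continuous_on_meval\<close>)
  define \<rho> :: "nat \<Rightarrow> unit mpoly" where
    "\<rho> j = Poly_Mapping.single (Poly_Mapping.single () (2 * N)) ((1 / U j) ^ (2 * N))" for j
  define s where "s j = usubst (Const (U j) - g j) (\<rho> j) * g j" for j
  have \<rho>: "\<rho> j \<in> class_polys K UNIV" if "j \<in> {1..m}" for j K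
    using U_pos that unfolding \<rho>_def
    by (intro nonneg_even_in_class even_power_in_nonneg_coeff_polys) (auto simp: less_imp_le)
  have s: "s j = Const ((1 / U j) ^ (2 * N)) * (Const (U j) - g j) ^ (2 * N) * g j" for j
    by (simp add: s_def \<rho>_def usubst_def)
  have s_in: "s j \<in> polys_in (I (ell j))" if "j \<in> {1..m}" for j
    unfolding s using g that
    by (intro polys_in_mult polys_in_power polys_in_diff Const_in_polys_in) auto
  obtain r where r: "\<forall>l\<in>{1..k}. r l \<in> polys_in (I l)" "p = (\<Sum>l=1..k. r l)"
    using sparse unfolding sparse_poly_def by blast
  \<comment> \<open>The correction term of constraint \<open>j\<close> is charged to the clique \<open>ell j\<close> that contains its variables.\<close>
  define q where "q l = r l - (\<Sum>j | j \<in> {1..m} \<and> ell j = l. s j)" for l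
  have "(\<Sum>l=1..k. \<Sum>j | j \<in> {1..m} \<and> ell j = l. s j) = (\<Sum>j=1..m. s j)"
    using ell by (intro sum.group) auto
  then have q_sum: "(\<Sum>l=1..k. q l) = p - (\<Sum>j=1..m. s j)"
    by (simp add: q_def r(2) sum_subtractf)
  have "\<exists>q'. (\<forall>l\<in>{1..k}. q' l \<in> polys_in (I l)) \<and> (\<Sum>l=1..k. q' l) = (\<Sum>l=1..k. q l) \<and>
    (\<forall>l\<in>{1..k}. \<forall>x. L2_set (($) x) (I l) \<le> R l \<longrightarrow> 0 < meval (q' l) x)"
  proof (rule positive_summands_on_sparse_ball[OF k rip R_pos])
    show "\<forall>l\<in>{1..k}. q l \<in> polys_in (I l)"
      unfolding q_def using r(1) s_in by (auto intro!: polys_in_diff polys_in_sum)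
    show "\<forall>x\<in>sparse_ball k I R. 0 < (\<Sum>l=1..k. meval (q l) x)"
    proof
      fix x assume "x \<in> sparse_ball k I R"
      from N[OF this] have "0 < meval (p - (\<Sum>j=1..m. s j)) x"
        by (simp add: s power_divide)
      then show "0 < (\<Sum>l=1..k. meval (q l) x)" unfolding q_sum[symmetric] by simp
    qed
  qed
  then obtain q' where q': "\<forall>l\<in>{1..k}. q' l \<in> polys_in (I l)" "(\<Sum>l=1..k. q' l) = (\<Sum>l=1..k. q l)"
    "\<forall>l\<in>{1..k}. \<forall>x. L2_set (($) x) (I l) \<le> R l \<longrightarrow> 0 < meval (q' l) x" by blast
  have "\<forall>l\<in>{1..k}. q' l \<in> ball_semiring (I l) (R l)"
    using q' R_pos by (intro ballI positive_on_ball_in_ball_semiring) auto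
  then obtain a b where ab: "\<forall>l\<in>{1..k}. a l \<in> nonneg_coeff_polys (even_exponents (yzu_vars (I l))) \<and>
      b l \<in> nonneg_coeff_polys (even_exponents (yzu_vars (I l))) \<and>
      q' l = yzu_subst (I l) (R l) (a l) + yzu_subst (I l) (R l) (b l) * ball_poly (I l) (R l)"
    unfolding ball_semiring_def by simp metis
  have "p = (\<Sum>l=1..k. q' l) + (\<Sum>j=1..m. s j)" unfolding q'(2) q_sum by simp
  also have "(\<Sum>l=1..k. q' l) = (\<Sum>l=1..k. yzu_subst (I l) (R l) (a l)
      + yzu_subst (I l) (R l) (b l) * ball_poly (I l) (R l))"
    using ab by (intro sum.cong) auto
  finally have p: "p = \<dots> + (\<Sum>j=1..m. s j)" .
  show ?thesis
  proof (intro conjI allI)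
    fix K
    define \<alpha> where "\<alpha> i = (if i = 0 then a else b)" for i :: nat
    have "\<forall>j\<in>{0, 1}. \<forall>l\<in>{1..k}. \<alpha> j l \<in> class_polys K (yzu_vars (I l))"
      using ab nonneg_even_in_class by (auto simp: \<alpha>_def)
    moreover have "p = (\<Sum>l=1..k. yzu_subst (I l) (R l) (\<alpha> 0 l)
          + yzu_subst (I l) (R l) (\<alpha> 1 l) * ball_poly (I l) (R l))
        + (\<Sum>j=1..m. usubst (Const (U j) - g j) (\<rho> j) * g j)"
      using p by (simp add: \<alpha>_def s_def)
    ultimately show "\<exists>(\<alpha> :: nat \<Rightarrow> nat \<Rightarrow> 'n yzu mpoly) (\<rho> :: nat \<Rightarrow> unit mpoly).
        (\<forall>j\<in>{0, 1}. \<forall>l\<in>{1..k}. \<alpha> j l \<in> class_polys K (yzu_vars (I l))) \<and>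
        (\<forall>j\<in>{1..m}. \<rho> j \<in> class_polys K UNIV) \<and>
        p = (\<Sum>l=1..k. yzu_subst (I l) (R l) (\<alpha> 0 l)
                       + yzu_subst (I l) (R l) (\<alpha> 1 l) * ball_poly (I l) (R l))
            + (\<Sum>j=1..m. usubst (Const (U j) - g j) (\<rho> j) * g j)"
      using \<rho> by blast
  next
    define \<alpha> where "\<alpha> l = a l + b l * Var UVar" for l
    have "\<forall>l\<in>{1..k}. \<alpha> l \<in> sag (yzu_vars (I l))"
      unfolding \<alpha>_def using ab by (intro ballI nonneg_even_plus_var_in_sag) (auto simp: yzu_vars_def)
    moreover have "\<forall>j\<in>{1..m}. \<rho> j \<in> sag UNIV" using \<rho>[of _ SAG] by simp
    moreover have "p = (\<Sum>l=1..k. yzu_subst (I l) (R l) (\<alpha> l))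
        + (\<Sum>j=1..m. usubst (Const (U j) - g j) (\<rho> j) * g j)"
      using p by (simp add: \<alpha>_def s_def yzu_subst_def)
    ultimately show "\<exists>(\<alpha> :: nat \<Rightarrow> 'n yzu mpoly) (\<rho> :: nat \<Rightarrow> unit mpoly).
        (\<forall>l\<in>{1..k}. \<alpha> l \<in> sag (yzu_vars (I l))) \<and>
        (\<forall>j\<in>{1..m}. \<rho> j \<in> sag UNIV) \<and>
        p = (\<Sum>l=1..k. yzu_subst (I l) (R l) (\<alpha> l))
            + (\<Sum>j=1..m. usubst (Const (U j) - g j) (\<rho> j) * g j)"
      by blast
  qed
qed

end
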